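(* Let $\omega$ be a radial weight on $\mathbb{D}$. Then $H_\omega: H^\infty\to\mathcal{B}$ is bounded if and only if $\omega\in\widehat{\mathcal{D}}$.
   Context: $\mathbb{D}=\{z\in\mathbb{C}:|z|<1\}$, and $dA=\frac{dx\,dy}{\pi}$ is the normalized area measure. $\mathcal{H}(\mathbb{D})$ is the space of analytic functions on $\mathbb{D}$. A radial weight is a nonnegative function $\omega\in L^1_{[0,1)}$, extended to $\mathbb{D}$ by $\omega(z)=\omega(|z|)$; it is assumed throughout that $\widehat{\omega}(z)=\int_{|z|}^1\omega(s)\,ds>0$ for all $z\in\mathbb{D}$. The Bergman space $A^2_\omega$ consists of the $f\in\mathcal{H}(\mathbb{D})$ with $\int_{\mathbb{D}}|f|^2\omega\,dA<\infty$. Its reproducing kernels $B^\omega_z\in A^2_\omega$ satisfy $f(z)=\int_{\mathbb{D}}f(\zeta)\overline{B^\omega_z(\zeta)}\,\omega(\zeta)\,dA(\zeta)$ for all $f\in A^2_\omega$. Explicitly, $B^\omega_z(\zeta)=\sum_{n=0}^\infty\frac{(\overline{z}\zeta)^n}{2\omega_{2n+1}}$, where $\omega_x=\int_0^1r^x\omega(r)\,dr$ for $x\ge0$. The Hilbert-type operator is $$H_\omega(f)(z)=\int_0^1 f(t)\left(\frac1z\int_0^zB^\omega_t(\zeta)\,d\zeta\right)\omega(t)\,dt,$$ where the kernel $\frac1z\int_0^zB^\omega_t(\zeta)\,d\zeta$ is extended analytically to $z=0$. A function on $\mathbb{D}$ is evaluated in this formula through its restriction to $[0,1)$. $H^\infty$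 is the space of bounded analytic functions on $\mathbb{D}$ with the supremum norm. The Bloch space $\mathcal{B}$ consists of the $f\in\mathcal{H}(\mathbb{D})$ with $\|f\|_{\mathcal{B}}=|f(0)|+\sup_{z\in\mathbb{D}}(1-|z|^2)|f'(z)|<\infty$. A radial weight $\omega$ belongs to $\widehat{\mathcal{D}}$ if there is a constant $C=C(\omega)\ge1$ with $\widehat{\omega}(r)\le C\,\widehat{\omega}\left(\frac{1+r}{2}\right)$ for all $0\le r<1$. *)

theory Defs
  imports "HOL-Complex_Analysis.Complex_Analysis"
begin

abbreviation unit_disc :: "complex set" where
  "unit_disc \<equiv> ball 0 1"

text \<open>A radial weight is given by its profile on \<open>[0,1)\<close>; its value at a point \<open>z\<close> of the disc is
  \<open>\<omega> (cmod z)\<close>. Values of the profile outside \<open>[0,1)\<close> are never used.\<close>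

definition weight_tail :: "(real \<Rightarrow> real) \<Rightarrow> real \<Rightarrow> real" where
  "weight_tail \<omega> r = (LINT s:{r..<1}|lebesgue. \<omega> s)"

definition radial_weight :: "(real \<Rightarrow> real) \<Rightarrow> bool" where
  "radial_weight \<omega> \<longleftrightarrow>
     (\<forall>r\<in>{0..<1}. 0 \<le> \<omega> r) \<and>
     set_integrable lebesgue {0..<1} \<omega> \<and>
     (\<forall>z\<in>unit_disc. 0 < weight_tail \<omega> (cmod z))"

definition D_hat :: "(real \<Rightarrow> real) set" where
  "D_hat = {\<omega>. radial_weight \<omega> \<and>
     (\<exists>C\<ge>1. \<forall>r. 0 \<le> r \<and> r < 1 \<longrightarrow> weight_tail \<omega> r \<le> C * weight_tail \<omega> ((1 + r) / 2))}"

definition disc_integral :: "(complex \<Rightarrow> complex) \<Rightarrow> complex" where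
  "disc_integral g = (LINT z:unit_disc|lebesgue. g z) / of_real pi"

definition bergman_space :: "(real \<Rightarrow> real) \<Rightarrow> (complex \<Rightarrow> complex) set" where
  "bergman_space \<omega> = {f. f holomorphic_on unit_disc \<and>
     set_integrable lebesgue unit_disc (\<lambda>z. (cmod (f z))\<^sup>2 * \<omega> (cmod z))}"

definition reproducing_kernel_at ::
    "(real \<Rightarrow> real) \<Rightarrow> complex \<Rightarrow> (complex \<Rightarrow> complex) \<Rightarrow> bool" where
  "reproducing_kernel_at \<omega> z k \<longleftrightarrow> k \<in> bergman_space \<omega> \<and>
     (\<forall>f\<in>bergman_space \<omega>.
        f z = disc_integral (\<lambda>\<zeta>. f \<zeta> * cnj (k \<zeta>) * of_real (\<omega> (cmod \<zeta>))))"

text \<open>For \<open>z\<close> in the disc the reproducing kernel exists and is unique as a function on the disc, where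
  it equals \<open>\<zeta> \<mapsto> \<Sum>n. (cnj z * \<zeta>)^n / (2 * \<omega>\<^sub>2\<^sub>n\<^sub>+\<^sub>1)\<close>, with \<open>\<omega>\<^sub>x\<close> the moment of order \<open>x\<close>. The choice
  operator only fixes irrelevant values outside the disc.\<close>

definition bergman_kernel :: "(real \<Rightarrow> real) \<Rightarrow> complex \<Rightarrow> complex \<Rightarrow> complex" where
  "bergman_kernel \<omega> z = (SOME k. reproducing_kernel_at \<omega> z k)"

text \<open>The constant \<open>remove_sings\<close> supplies the analytic extension to \<open>z = 0\<close>; at all other points of
  the disc it does not change the function.\<close>

definition hilbert_kernel :: "(real \<Rightarrow> real) \<Rightarrow> real \<Rightarrow> complex \<Rightarrow> complex" where
  "hilbert_kernel \<omega> t =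
     remove_sings (\<lambda>z. 1 / z * contour_integral (linepath 0 z) (bergman_kernel \<omega> (of_real t)))"

definition hilbert_op :: "(real \<Rightarrow> real) \<Rightarrow> (complex \<Rightarrow> complex) \<Rightarrow> complex \<Rightarrow> complex" where
  "hilbert_op \<omega> f z =
     (LINT t:{0..<1}|lebesgue. f (of_real t) * hilbert_kernel \<omega> t z * of_real (\<omega> t))"

definition H_infinity :: "(complex \<Rightarrow> complex) set" where
  "H_infinity = {f. f holomorphic_on unit_disc \<and> bounded (f ` unit_disc)}"

definition H_infinity_norm :: "(complex \<Rightarrow> complex) \<Rightarrow> real" where
  "H_infinity_norm f = (SUP z\<in>unit_disc. cmod (f z))"

definition bloch_space :: "(complex \<Rightarrow> complex) set" where
  "bloch_space = {f. f holomorphic_on unit_disc \<and>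
     bdd_above ((\<lambda>z. (1 - (cmod z)\<^sup>2) * cmod (deriv f z)) ` unit_disc)}"

definition bloch_norm :: "(complex \<Rightarrow> complex) \<Rightarrow> real" where
  "bloch_norm f = cmod (f 0) + (SUP z\<in>unit_disc. (1 - (cmod z)\<^sup>2) * cmod (deriv f z))"

definition bounded_H_infinity_to_bloch ::
    "((complex \<Rightarrow> complex) \<Rightarrow> complex \<Rightarrow> complex) \<Rightarrow> bool" where
  "bounded_H_infinity_to_bloch T \<longleftrightarrow>
     (\<exists>C. \<forall>f\<in>H_infinity. T f \<in> bloch_space \<and> bloch_norm (T f) \<le> C * H_infinity_norm f)"

end

theory Submission
  imports Defs
begin

text \<open>Write \<open>M n\<close> for the \<open>n\<close>-th moment of the weight. The Bergman kernel at \<open>t\<close> in \<open>[0,1)\<close> is the power series with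
  coefficients \<open>t ^ n / (2 * M (2 * n + 1))\<close>; averaging it over the segment from 0 to \<open>z\<close> divides the \<open>n\<close>-th coefficient
  by \<open>n + 1\<close>. Hence, for bounded \<open>f\<close>, the function \<open>hilbert_op \<omega> f\<close> has the coefficients
  \<open>(\<integral>t. f t * t ^ n * \<omega> t) / (2 * (n + 1) * M (2 * n + 1))\<close>, of modulus at most the
  supremum of \<open>f\<close> times \<open>M n / (2 * (n + 1) * M (2 * n + 1))\<close>. If \<open>M n \<le> A * M (2 * n + 1)\<close>, the
  coefficients of the derivative are bounded and a geometric series yields the Bloch norm estimate
  (\<open>bounded_of_moment_doubling\<close>).

  Conversely, the image of the constant 1 has nonnegative coefficients, and a Bloch bound for it says that the sums
  of \<open>M k / M (2 * k + 1)\<close> over \<open>k \<le> N\<close> are of order \<open>N\<close>. As moments decrease, the last quarter of the sum makes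
  \<open>M N\<close> comparable with the moment of order \<open>3 * N / 2\<close>, and hence with \<open>M (2 * N)\<close>
  (\<open>moment_doubling_of_bounded\<close>).

  Boundedness is thus a doubling property of the moments, and it remains to see that this is the doubling property
  of the tails. From tails to moments, write moments as integrals of tails and substitute \<open>(1 + x) / 2\<close> for \<open>x\<close>
  (\<open>moment_doubling_of_D_hat\<close>); from moments to tails, iterate the doubling until the contribution of the smaller
  radii is negligible (\<open>D_hat_of_moment_doubling\<close>).

  The kernel is given by its reproducing property. Its expansion (\<open>bergman_kernel_eq_kernel_series\<close>) rests on the
  orthogonality of the monomials for radial weights, which follows from two facts about area: it is
  invariant under rotations (\<open>lborel_rotate\<close>), and its image under the modulus is explicit
  (\<open>lborel_cmod\<close>).\<close>

section \<open>Rotations and radial integration in the disc\<close>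

text \<open>The change of variables theorem for linear maps lives on \<open>real ^ 'n\<close>, while the area measure of
  the disc lives on \<open>complex\<close>. The identification of the two planes carries it over.\<close>
definition complex_of_vec :: "real^2 \<Rightarrow> complex" where
  "complex_of_vec x = Complex (x $ 1) (x $ 2)"

definition vec_of_complex :: "complex \<Rightarrow> real^2" where
  "vec_of_complex z = vector [Re z, Im z]"

lemma vec_of_complex_of_vec [simp]: "vec_of_complex (complex_of_vec x) = x"
  by (simp add: vec_of_complex_def complex_of_vec_def vec_eq_iff forall_2)

lemma complex_of_vec_of_complex [simp]: "complex_of_vec (vec_of_complex z) = z"
  by (simp add: vec_of_complex_def complex_of_vec_def)

lemma linear_complex_of_vec: "linear complex_of_vec"
  by (rule linearI) (auto simp: complex_of_vec_def complex_eq_iff)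

lemma linear_vec_of_complex: "linear vec_of_complex"
  by (rule linearI) (auto simp: vec_of_complex_def vec_eq_iff forall_2)

lemma norm_vec_of_complex [simp]: "norm (vec_of_complex z) = cmod z"
  by (simp add: vec_of_complex_def norm_vec_def L2_set_def sum_2 cmod_def)

lemma measurable_complex_of_vec [measurable]: "complex_of_vec \<in> borel_measurable borel"
  by (intro borel_measurable_continuous_onI linear_continuous_on linear_linear[THEN iffD2] linear_complex_of_vec)

lemma lborel_complex_of_vec: "lborel = distr lborel borel complex_of_vec"
proof (rule lborel_eqI)
  fix l u :: complex
  assume "\<And>b. b \<in> Basis \<Longrightarrow> l \<bullet> b \<le> u \<bullet> b"
  then have le: "Re l \<le> Re u" "Im l \<le> Im u" 
    by (auto simp: Basis_complex_def dest: meta_spec[of _ 1] meta_spec[of _ \<i>])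
  have "complex_of_vec -` box l u = box (vec_of_complex l) (vec_of_complex u)"
    by (auto simp: complex_of_vec_def vec_of_complex_def mem_box_cart forall_2 in_box_complex_iff)
  moreover have "Basis = {axis 1 1, axis 2 (1::real) :: real^2}"
    by (auto simp: Basis_vec_def exhaust_2 forall_2) (metis exhaust_2)+
  moreover have "\<forall>b\<in>Basis. vec_of_complex l \<bullet> b \<le> vec_of_complex u \<bullet> b"
    "(\<Prod>b\<in>Basis. (vec_of_complex u - vec_of_complex l) \<bullet> b) = (Re u - Re l) * (Im u - Im l)"
    unfolding calculation(2) using le by (auto simp: vec_of_complex_def inner_axis axis_eq_axis)
  ultimately show "emeasure (distr lborel borel complex_of_vec) (box l u) = (\<Prod>b\<in>Basis. (u - l) \<bullet> b)"
    by (simp add: emeasure_distr emeasure_lborel_box_eq Basis_complex_def)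
qed simp

text \<open>Multiplication by a unimodular number is an orthogonal transformation of the plane.\<close>
lemma lborel_rotate:
  assumes "cmod c = 1"
  shows "distr lborel borel ((*) c) = lborel"
proof -
  define f where "f = (\<lambda>x. vec_of_complex (c * complex_of_vec x))"
  have linf: "linear f"
    unfolding f_def using linear_complex_of_vec linear_vec_of_complex
    by (auto simp: linear_iff algebra_simps)
  have normf: "norm (f x) = norm x" for x
    using assms norm_vec_of_complex[of "complex_of_vec x"] by (simp add: f_def norm_mult)
  have orth: "orthogonal_transformation f"
    using linf normf by (simp add: orthogonal_transformation)
  have c0: "c \<noteq> 0" using assms by auto
  show ?thesis
  proof (rule lborel_eqI[symmetric])
    fix l u :: complex
    assume le: "\<And>b. b \<in> Basis \<Longrightarrow> l \<bullet> b \<le> u \<bullet> b"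
    define B where "B = complex_of_vec -` box l u"
    define A where "A = complex_of_vec -` ((*) c -` box l u)"
    have mB [measurable]: "B \<in> sets borel" unfolding B_def
      using measurable_sets[OF measurable_complex_of_vec, of "box l u"] by simp
    have mA [measurable]: "A \<in> sets borel" unfolding A_def
      using measurable_sets[of "\<lambda>x. c * complex_of_vec x" borel borel "box l u"] by (simp add: vimage_def)
    have eB: "emeasure lborel B = emeasure lborel (box l u)"
      by (simp add: emeasure_distr B_def arg_cong[OF lborel_complex_of_vec, of "\<lambda>M. emeasure M (box l u)"])
    have fA: "f ` A = B"
    proof
      show "f ` A \<subseteq> B" by (auto simp: A_def B_def f_def)
      show "B \<subseteq> f ` A"
      proof
        fix x assume "x \<in> B"
        then have "vec_of_complex (complex_of_vec x / c) \<in> A" "f (vec_of_complex (complex_of_vec x / c)) = x"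
          using c0 by (auto simp: A_def B_def f_def)
        then show "x \<in> f ` A" by force
      qed
    qed
    have bA: "bounded A"
    proof -
      obtain K where K: "\<And>z. z \<in> box l u \<Longrightarrow> cmod z \<le> K"
        using bounded_box[of l u] by (auto simp: bounded_iff)
      have "norm x \<le> K" if "x \<in> A" for x
        using K[of "c * complex_of_vec x"] that assms norm_vec_of_complex[of "complex_of_vec x"]
        by (auto simp: A_def norm_mult)
      then show ?thesis by (auto simp: bounded_iff)
    qed
    have lA: "A \<in> lmeasurable"
      by (intro bounded_set_imp_lmeasurable bA) (use mA in auto)
    have "measure lebesgue B = measure lebesgue A" "B \<in> lmeasurable"
      using measure_orthogonal_image[OF orth lA] measurable_orthogonal_image[OF orth lA] fA by auto
    then have "emeasure lebesgue B = emeasure lebesgue A"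
      using lA by (metis emeasure_eq_measure2)
    then have "emeasure lborel B = emeasure lborel A" by simp
    moreover have "emeasure (distr lborel borel ((*) c)) (box l u) = emeasure lborel A"
      by (subst lborel_complex_of_vec) (simp add: emeasure_distr A_def vimage_def)
    ultimately show "emeasure (distr lborel borel ((*) c)) (box l u) = (\<Prod>b\<in>Basis. (u - l) \<bullet> b)"
      using eB le by (simp add: emeasure_lborel_box)
  qed simp
qed

text \<open>The radial half of polar coordinates: the push-forward of area under the modulus has density
  \<open>2 * pi * r\<close>, because it gives \<open>{x<..}\<close> the area \<open>pi * (1 - x\<^sup>2)\<close> of an annulus.\<close>
lemma lborel_cmod:
  "distr (density lborel (\<lambda>z. ennreal (indicator (ball 0 1) z))) borel cmod =
     density lborel (\<lambda>r::real. ennreal (indicator {0..<1} r * (2 * pi * r)))" (is "?M = ?N")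
proof (rule measure_eqI_lessThan)
  have M: "emeasure ?M {x<..} = emeasure lborel (ball 0 1 - cball (0::complex) x)" for x
  proof -
    have [measurable]: "{z. x < cmod z} \<in> sets borel"
      by (intro borel_open open_Collect_less continuous_intros)
    have "emeasure ?M {x<..} = (\<integral>\<^sup>+z. indicator (ball 0 1) z * indicator {z. x < cmod z} z \<partial>(lborel :: complex measure))"
      by (subst emeasure_distr, simp, simp, subst emeasure_density) (auto simp: vimage_def intro!: borel_measurable_indicator nn_integral_cong split: split_indicator)
    also have "\<dots> = (\<integral>\<^sup>+z. indicator (ball 0 1 - cball 0 x) z \<partial>(lborel :: complex measure))"
      by (intro nn_integral_cong) (auto simp: indicator_def)
    finally show ?thesis by simp
  qed
  have N: "emeasure ?N {x<..} = (\<integral>\<^sup>+r. ennreal (2 * pi * r) * indicator {max 0 x..1} r \<partial>lborel)" for x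
  proof -
    have "AE r in lborel. r \<noteq> 1 \<and> r \<noteq> x" by (auto intro!: AE_conjI AE_lborel_singleton)
    then show ?thesis
      by (subst emeasure_density, measurable, intro nn_integral_cong_AE)
         (auto simp: indicator_def ennreal_mult' elim!: AE_mp)
  qed
  show "emeasure ?M {x<..} < \<infinity>" for x
    unfolding M by (rule le_less_trans[OF emeasure_mono emeasure_lborel_ball_finite[of 0 1]]) auto
  show "emeasure ?M {x<..} = emeasure ?N {x<..}" for x
  proof (cases "x < 1")
    case True
    have "emeasure lborel (ball 0 1 - cball (0::complex) x) = ennreal (pi * (1 - (max 0 x)\<^sup>2))"
    proof (cases "x \<ge> 0")
      case x: True
      have "emeasure lborel (ball 0 1 - cball (0::complex) x) =
          emeasure lborel (ball (0::complex) 1) - emeasure lborel (cball (0::complex) x)"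
        using True emeasure_lborel_cball_finite[of "0::complex" x] by (intro emeasure_Diff) auto
      then show ?thesis using x True
        by (simp add: emeasure_ball emeasure_cball unit_ball_vol_2 ennreal_minus algebra_simps)
    qed (auto simp: emeasure_ball unit_ball_vol_2)
    moreover have "(\<integral>\<^sup>+r. ennreal (2 * pi * r) * indicator {max 0 x..1} r \<partial>lborel) = ennreal (pi * 1\<^sup>2 - pi * (max 0 x)\<^sup>2)"
      by (rule nn_integral_FTC_Icc) (use True in \<open>auto intro!: derivative_eq_intros\<close>)
    ultimately show ?thesis unfolding M N by (simp add: algebra_simps)
  next
    case False
    have "(\<integral>\<^sup>+r. ennreal (2 * pi * r) * indicator {max 0 x..1} r \<partial>lborel) = (\<integral>\<^sup>+r. 0 \<partial>(lborel::real measure))"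
      using AE_lborel_singleton[of 1] False
      by (intro nn_integral_cong_AE) (auto simp: indicator_def elim!: AE_mp)
    moreover have "ball 0 1 - cball (0::complex) x = {}" using False by auto
    ultimately show ?thesis unfolding M N by (simp only: emeasure_empty nn_integral_0_iff_AE nn_integral_const) simp
  qed
qed auto

text \<open>A weight is only Lebesgue measurable, whereas the push-forward formulas above concern Borel
  functions. A Borel representative of the profile bridges the gap; that composing with the modulus
  respects null sets is the content of the next lemma.\<close>
lemma borel_representative:
  fixes F :: "real \<Rightarrow> real"
  assumes "set_borel_measurable lebesgue {0..<1} F"
  obtains G where "G \<in> borel_measurable borel" "AE r in lborel. r \<in> {0..<1} \<longrightarrow> F r = G r"
proof -
  have "(\<lambda>r. indicator {0..<1} r *\<^sub>R F r) \<in> borel_measurable lebesgue"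
    using assms by (simp add: set_borel_measurable_def)
  then obtain G where "G \<in> borel_measurable lborel" and ae: "AE r in lborel. indicator {0..<1} r *\<^sub>R F r = G r"
    using completion_ex_borel_measurable_real by blast
  moreover have "AE r in lborel. r \<in> {0..<1} \<longrightarrow> F r = G r"
    using ae by eventually_elim (auto simp: indicator_def)
  ultimately show thesis using that by simp
qed

lemma AE_cmod:
  assumes "AE r in lborel. r \<in> {0..<1} \<longrightarrow> P r"
  shows "AE z in lborel. z \<in> ball (0::complex) 1 \<longrightarrow> P (cmod z)"
proof -
  obtain N where N: "N \<in> null_sets lborel" "{r. \<not> (r \<in> {0..<1} \<longrightarrow> P r)} \<subseteq> N"
    using assms by (auto simp: eventually_ae_filter)
  then have [measurable]: "N \<in> sets borel" by auto
  have "AE r in lborel. r \<notin> N" using N(1) by (rule AE_not_in)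
  then have "AE r in density lborel (\<lambda>r::real. ennreal (indicator {0..<1} r * (2 * pi * r))). r \<notin> N"
    by (subst AE_density) (measurable, auto elim!: AE_mp)
  then have "AE z in density lborel (\<lambda>z. ennreal (indicator (ball (0::complex) 1) z)). cmod z \<notin> N"
    unfolding lborel_cmod[symmetric] by (subst (asm) AE_distr_iff) auto
  then have "AE z in lborel. z \<in> ball (0::complex) 1 \<longrightarrow> cmod z \<notin> N"
    by (subst (asm) AE_density) (auto elim!: AE_mp simp: indicator_def)
  moreover have "P (cmod z)" if "cmod z < 1" "cmod z \<notin> N" for z :: complex
    using N(2) that norm_ge_zero[of z] unfolding subset_iff by (metis (no_types, lifting) atLeastLessThan_iff mem_Collect_eq)
  ultimately show ?thesis by (auto elim!: eventually_mono)
qed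

lemma radial_set_integral:
  fixes F :: "real \<Rightarrow> real"
  assumes "set_integrable lebesgue {0..<1} (\<lambda>r. r * F r)" "set_borel_measurable lebesgue {0..<1} F"
  shows "set_integrable lebesgue (ball 0 1) (\<lambda>z::complex. F (cmod z))" (is ?int)
    and "(LINT z:ball (0::complex) 1|lebesgue. F (cmod z)) = 2 * pi * (LINT r:{0..<1}|lebesgue. r * F r)" (is ?eq)
proof -
  obtain G where [measurable]: "G \<in> borel_measurable borel" and ae: "AE r in lborel. r \<in> {0..<1} \<longrightarrow> F r = G r"
    using borel_representative[OF assms(2)] .
  define g where "g = (\<lambda>r. indicator {0..<1} r *\<^sub>R (r * G r))"
  define h where "h = (\<lambda>z::complex. indicator (ball 0 1) z *\<^sub>R G (cmod z))"
  have [measurable]: "g \<in> borel_measurable borel" "h \<in> borel_measurable borel"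
    unfolding g_def h_def by (measurable, auto intro!: borel_measurable_scaleR borel_measurable_indicator)
  have 1: "AE r in lebesgue. g r = indicator {0..<1} r *\<^sub>R (r * F r)"
    unfolding g_def using AE_completion[OF ae] by eventually_elim (auto simp: indicator_def)
  have 2: "AE z in lebesgue. h z = indicator (ball 0 1) z *\<^sub>R F (cmod z)"
    unfolding h_def using AE_completion[OF AE_cmod[OF ae]] by eventually_elim (auto simp: indicator_def)
  have g: "g \<in> borel_measurable lebesgue" and h: "h \<in> borel_measurable lebesgue"
    by (auto intro: measurable_completion)
  note gF = borel_measurable_AE[OF g 1] and hF = borel_measurable_AE[OF h 2]
  have ig: "integrable lborel g"
    using integrable_cong_AE[OF g gF 1] assms(1) by (simp add: set_integrable_def integrable_completion)
  have "integrable lborel (\<lambda>r. (indicator {0..<1} r * (2 * pi * r)) *\<^sub>R G r)"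
    using integrable_mult_right[OF ig, of "2 * pi"] by (simp add: g_def mult_ac)
  then have "integrable (density lborel (\<lambda>r::real. ennreal (indicator {0..<1} r * (2 * pi * r)))) G"
    by (subst integrable_density) (auto simp: indicator_def)
  then have "integrable (density lborel (\<lambda>z. ennreal (indicator (ball (0::complex) 1) z))) (\<lambda>z. G (cmod z))"
    unfolding lborel_cmod[symmetric] by (subst (asm) integrable_distr_eq) auto
  then have ih: "integrable lborel h"
    unfolding h_def by (subst (asm) integrable_density) (auto simp: borel_measurable_indicator)
  show ?int
    using integrable_cong_AE[OF h hF 2] ih by (simp add: set_integrable_def integrable_completion)
  have "(LINT z:ball (0::complex) 1|lebesgue. F (cmod z)) = integral\<^sup>L lborel h"
    using integral_cong_AE[OF h hF 2] by (simp add: set_lebesgue_integral_def integral_completion)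
  also have "\<dots> = (LINT z|density lborel (\<lambda>z. ennreal (indicator (ball 0 1) z)). G (cmod z))"
    unfolding h_def by (subst integral_density) (auto simp: borel_measurable_indicator)
  also have "\<dots> = integral\<^sup>L (density lborel (\<lambda>r::real. ennreal (indicator {0..<1} r * (2 * pi * r)))) G"
    unfolding lborel_cmod[symmetric] by (subst integral_distr) auto
  also have "\<dots> = (LINT r|lborel. 2 * pi * g r)"
    unfolding g_def by (subst integral_density) (auto simp: mult_ac indicator_def intro!: Bochner_Integration.integral_cong)
  also have "\<dots> = 2 * pi * (LINT r:{0..<1}|lebesgue. r * F r)"
    using integral_cong_AE[OF g gF 1] by (simp add: set_lebesgue_integral_def integral_completion)
  finally show ?eq .
qed

text \<open>Instead of integrating over the angle, rotate once: with \<open>d = \<bar>m - n\<bar>\<close>, the rotation by the angle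
  \<open>pi / d\<close> preserves the integral and changes the sign of the integrand.\<close>
lemma disc_monomial_orthogonal:
  fixes F :: "real \<Rightarrow> real"
  assumes "set_borel_measurable lebesgue {0..<1} F" "m \<noteq> n"
  shows "(LINT z:ball 0 1|lebesgue. z ^ m * cnj z ^ n * of_real (F (cmod z))) = 0"
proof -
  obtain G where [measurable]: "G \<in> borel_measurable borel" and ae: "AE r in lborel. r \<in> {0..<1} \<longrightarrow> F r = G r"
    using borel_representative[OF assms(1)] .
  define h where "h = (\<lambda>z::complex. indicator (ball 0 1) z *\<^sub>R (z ^ m * cnj z ^ n * of_real (G (cmod z))))"
  have [measurable]: "cnj \<in> borel_measurable borel"
    by (intro borel_measurable_continuous_onI continuous_intros)
  have hm [measurable]: "h \<in> borel_measurable borel"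
    unfolding h_def by (intro borel_measurable_scaleR borel_measurable_indicator) auto
  have 2: "AE z in lebesgue. h z = indicator (ball 0 1) z *\<^sub>R (z ^ m * cnj z ^ n * of_real (F (cmod z)))"
    unfolding h_def using AE_completion[OF AE_cmod[OF ae]] by eventually_elim (auto simp: indicator_def)
  have h: "h \<in> borel_measurable lebesgue" by (auto intro: measurable_completion)
  note hF = borel_measurable_AE[OF h 2]
  have eq: "(LINT z:ball 0 1|lebesgue. z ^ m * cnj z ^ n * of_real (F (cmod z))) = integral\<^sup>L lborel h"
    using integral_cong_AE[OF h hF 2] by (simp add: set_lebesgue_integral_def integral_completion)
  define d where "d = (if m > n then m - n else n - m)"
  define c where "c = cis (pi / d)"
  have d: "d > 0" using assms(2) by (auto simp: d_def)
  have c: "cmod c = 1" "c * cnj c = 1" by (auto simp: c_def cis_cnj cis_mult)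
  have cd: "c ^ d = -1" using d unfolding c_def by (subst Complex.DeMoivre) simp
  then have cd': "cnj c ^ d = -1" by (metis complex_cnj_minus complex_cnj_one complex_cnj_power)
  have cmn: "c ^ m * cnj c ^ n = -1"
  proof (cases "m > n")
    case True
    then have "c ^ m * cnj c ^ n = c ^ d * (c * cnj c) ^ n"
      unfolding power_mult_distrib by (simp add: d_def mult_ac flip: power_add)
    then show ?thesis using cd c by simp
  next
    case False
    then have "c ^ m * cnj c ^ n = cnj c ^ d * (c * cnj c) ^ m"
      unfolding power_mult_distrib by (simp add: d_def mult_ac flip: power_add)
    then show ?thesis using cd' c by simp
  qed
  have hc: "h (c * z) = - h z" for z
  proof -
    have "h (c * z) = (c ^ m * cnj c ^ n) * h z"
      using c(1) by (simp add: h_def norm_mult power_mult_distrib indicator_def)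
    then show ?thesis using cmn by simp
  qed
  have "integral\<^sup>L lborel h = integral\<^sup>L (distr lborel borel ((*) c)) h"
    by (simp add: lborel_rotate c)
  also have "\<dots> = (LINT z|lborel. h (c * z))" by (rule integral_distr) auto
  also have "\<dots> = - integral\<^sup>L lborel h" by (simp add: hc)
  finally show ?thesis using eq by (simp add: complex_eq_iff)
qed

section \<open>Moments of a radial weight and its Bergman kernel\<close>

definition moment :: "(real \<Rightarrow> real) \<Rightarrow> nat \<Rightarrow> real" where
  "moment \<omega> n = (LINT t:{0..<1}|lebesgue. t ^ n * \<omega> t)"

lemma set_borel_measurable_lebesgue_continuous:
  fixes g :: "'a::euclidean_space \<Rightarrow> 'b::real_normed_vector"
  assumes "continuous_on S g" "S \<in> sets borel"
  shows "set_borel_measurable lebesgue S g"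
  using borel_measurable_continuous_on_indicator[OF assms(2,1)]
  by (auto simp: set_borel_measurable_def intro: measurable_completion)

lemma set_integrable_bounded_mult:
  fixes g :: "'a::euclidean_space \<Rightarrow> 'b::{real_normed_field, second_countable_topology, banach}"
    and h :: "'a \<Rightarrow> 'b"
  assumes h: "set_integrable lebesgue S h" and g: "continuous_on S g" "\<And>x. x \<in> S \<Longrightarrow> norm (g x) \<le> K" and S: "S \<in> sets borel"
  shows "set_integrable lebesgue S (\<lambda>x. g x * h x)"
proof (rule set_integrable_bound)
  show "set_integrable lebesgue S (\<lambda>x. of_real K * h x)" using h by simp
  have "(\<lambda>x. (indicator S x *\<^sub>R g x) * (indicator S x *\<^sub>R h x)) \<in> borel_measurable lebesgue"
    using set_borel_measurable_lebesgue_continuous[OF g(1) S] h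
    by (intro borel_measurable_times) (auto simp: set_borel_measurable_def set_integrable_def)
  also have "(\<lambda>x. (indicator S x *\<^sub>R g x) * (indicator S x *\<^sub>R h x)) = (\<lambda>x. indicator S x *\<^sub>R (g x * h x))"
    by (auto simp: indicator_def)
  finally show "set_borel_measurable lebesgue S (\<lambda>x. g x * h x)" by (simp add: set_borel_measurable_def)
  show "AE x in lebesgue. x \<in> S \<longrightarrow> norm (g x * h x) \<le> norm (of_real K * h x)"
    using g(2) by (auto simp: norm_mult intro!: mult_right_mono AE_I2 order_trans[OF g(2)])
qed

definition taylor :: "(complex \<Rightarrow> complex) \<Rightarrow> nat \<Rightarrow> complex" where
  "taylor f n = (deriv ^^ n) f 0 / fact n"

lemma taylor_sums:
  assumes "f holomorphic_on unit_disc" "z \<in> unit_disc"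
  shows "(\<lambda>n. taylor f n * z ^ n) sums f z"
  using holomorphic_power_series[OF assms] by (simp add: taylor_def)

locale weight =
  fixes \<omega> :: "real \<Rightarrow> real"
  assumes radial: "radial_weight \<omega>"
begin

lemma nonneg: "0 \<le> t \<Longrightarrow> t < 1 \<Longrightarrow> 0 \<le> \<omega> t"
  using radial by (auto simp: radial_weight_def)

lemma integrable_weight: "set_integrable lebesgue {0..<1} \<omega>"
  using radial by (auto simp: radial_weight_def)

lemma tail_pos: "0 \<le> r \<Longrightarrow> r < 1 \<Longrightarrow> 0 < weight_tail \<omega> r"
  using radial[unfolded radial_weight_def] by (metis abs_of_nonneg mem_ball_0 norm_of_real)

lemma integrable_moment: "set_integrable lebesgue {0..<1} (\<lambda>t. t ^ n * \<omega> t)"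
  by (rule set_integrable_bounded_mult[OF integrable_weight, where K = 1])
     (auto intro!: continuous_intros power_le_one)

lemma moment_antimono:
  assumes "m \<le> n" shows "moment \<omega> n \<le> moment \<omega> m"
  unfolding moment_def using assms
  by (intro set_integral_mono integrable_moment mult_right_mono power_decreasing nonneg) auto

lemma tail_le_moment:
  assumes "0 \<le> r" "r < 1"
  shows "r ^ n * weight_tail \<omega> r \<le> moment \<omega> n"
proof -
  have "r ^ n * weight_tail \<omega> r = (LINT t:{r..<1}|lebesgue. r ^ n * \<omega> t)"
    by (simp add: weight_tail_def)
  also have "\<dots> \<le> (LINT t:{r..<1}|lebesgue. t ^ n * \<omega> t)"
    using assms
    by (intro set_integral_mono mult_right_mono power_mono nonneg set_integrable_mult_right
        set_integrable_subset[OF integrable_moment] set_integrable_subset[OF integrable_weight]) auto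
  also have "\<dots> \<le> moment \<omega> n"
    unfolding moment_def set_lebesgue_integral_def
    using set_integrable_subset[OF integrable_moment[of n], of "{r..<1}"] integrable_moment[of n] assms
    by (intro integral_mono) (auto simp: set_integrable_def indicator_def intro!: nonneg mult_nonneg_nonneg)
  finally show ?thesis .
qed

lemma moment_pos: "0 < moment \<omega> n"
  using tail_le_moment[of "1/2" n] tail_pos[of "1/2"]
  by (smt (verit) divide_pos_pos mult_pos_pos zero_less_power field_sum_of_halves)

text \<open>The moments decay slower than any geometric sequence, because \<open>r ^ n * weight_tail \<omega> r\<close> bounds them
  from below for every \<open>r < 1\<close>. Hence all the series below converge in the whole disc.\<close>
lemma summable_power_over_moment:
  fixes x :: real
  assumes "0 \<le> x" "x < 1"
  shows "summable (\<lambda>n. x ^ n / moment \<omega> (2 * n + 1))"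
proof -
  \<comment> \<open>any \<open>r < 1\<close> with \<open>x < r\<^sup>2\<close> would do\<close>
  define r where "r = sqrt ((1 + x) / 2)"
  have r: "0 < r" "r < 1" "r\<^sup>2 = (1 + x) / 2" using assms by (auto simp: r_def)
  have "summable (\<lambda>n. (x / r\<^sup>2) ^ n / (r * weight_tail \<omega> r))"
    using assms by (intro summable_divide summable_geometric) (auto simp: r)
  then show ?thesis
  proof (rule summable_comparison_test'[where N = 0])
    fix n
    have "r ^ (2 * n + 1) * weight_tail \<omega> r > 0" using r tail_pos[of r] by simp
    then have "x ^ n / moment \<omega> (2 * n + 1) \<le> x ^ n / (r ^ (2 * n + 1) * weight_tail \<omega> r)"
      using tail_le_moment[of r "2 * n + 1"] r assms by (intro divide_left_mono) (auto intro!: mult_pos_pos moment_pos)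
    also have "\<dots> = (x / r\<^sup>2) ^ n / (r * weight_tail \<omega> r)"
      by (simp add: power_divide power_mult power_add)
    finally show "norm (x ^ n / moment \<omega> (2 * n + 1)) \<le> (x / r\<^sup>2) ^ n / (r * weight_tail \<omega> r)"
      using assms moment_pos[of "2 * n + 1"] by simp
  qed
qed

lemma integrable_weight_disc: "set_integrable lebesgue unit_disc (\<lambda>z. \<omega> (cmod z))"
  using integrable_moment[of 1] integrable_weight
  by (intro radial_set_integral) (auto simp: set_borel_measurable_def set_integrable_def)

text \<open>From \<open>\<bar>f\<bar> \<le> 1 + \<bar>f\<bar>\<^sup>2\<close>: square integrability against the finite weight gives integrability.\<close>
lemma bergman_integrable:
  assumes "f \<in> bergman_space \<omega>"
  shows "set_integrable lebesgue unit_disc (\<lambda>z. f z * of_real (\<omega> (cmod z)))"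
proof (rule set_integrable_bound)
  show "set_integrable lebesgue unit_disc (\<lambda>z. \<omega> (cmod z) + (cmod (f z))\<^sup>2 * \<omega> (cmod z))"
    using assms by (intro set_integral_add integrable_weight_disc) (auto simp: bergman_space_def)
  have "continuous_on unit_disc f"
    using assms by (auto simp: bergman_space_def intro: holomorphic_on_imp_continuous_on)
  then have "(\<lambda>x. (indicator unit_disc x *\<^sub>R f x) * of_real (indicator unit_disc x *\<^sub>R \<omega> (cmod x))) \<in> borel_measurable lebesgue"
    using set_borel_measurable_lebesgue_continuous[of unit_disc f]
      borel_measurable_integrable[OF integrable_weight_disc[unfolded set_integrable_def]]
    by (intro borel_measurable_times borel_measurable_of_real) (auto simp: set_borel_measurable_def simp del: real_scaleR_def)
  also have "(\<lambda>x. (indicator unit_disc x *\<^sub>R f x) * of_real (indicator unit_disc x *\<^sub>R \<omega> (cmod x))) 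
     = (\<lambda>x. indicator unit_disc x *\<^sub>R (f x * of_real (\<omega> (cmod x))))"
    by (auto simp: indicator_def)
  finally show "set_borel_measurable lebesgue unit_disc (\<lambda>z. f z * of_real (\<omega> (cmod z)))"
    by (simp add: set_borel_measurable_def)
  have "norm (f z * of_real (\<omega> (cmod z))) \<le> norm (\<omega> (cmod z) + (cmod (f z))\<^sup>2 * \<omega> (cmod z))" if "z \<in> unit_disc" for z
  proof -
    have w: "0 \<le> \<omega> (cmod z)" using that by (intro nonneg) auto
    have "cmod (f z) \<le> 1 + (cmod (f z))\<^sup>2" by (smt (verit) self_le_power one_le_numeral pos2 zero_le_power2)
    then have "cmod (f z) * \<omega> (cmod z) \<le> (1 + (cmod (f z))\<^sup>2) * \<omega> (cmod z)" using w by (rule mult_right_mono)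
    then show ?thesis using w by (simp add: norm_mult algebra_simps)
  qed
  then show "AE z in lebesgue. z \<in> unit_disc \<longrightarrow> norm (f z * of_real (\<omega> (cmod z))) \<le> norm (\<omega> (cmod z) + (cmod (f z))\<^sup>2 * \<omega> (cmod z))"
    by auto
qed

lemma bergman_integrable_mult_cnj_power:
  assumes "f \<in> bergman_space \<omega>"
  shows "set_integrable lebesgue unit_disc (\<lambda>z. f z * cnj z ^ n * of_real (\<omega> (cmod z)))"
proof -
  have "set_integrable lebesgue unit_disc (\<lambda>z. cnj z ^ n * (f z * of_real (\<omega> (cmod z))))"
    by (rule set_integrable_bounded_mult[OF bergman_integrable[OF assms], where K = 1])
       (auto intro!: continuous_intros power_le_one simp: norm_power)
  then show ?thesis by (simp add: mult_ac)
qed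

lemma bounded_holomorphic_in_bergman_space:
  assumes "f holomorphic_on unit_disc" "\<And>z. z \<in> unit_disc \<Longrightarrow> cmod (f z) \<le> K"
  shows "f \<in> bergman_space \<omega>"
proof -
  have "continuous_on unit_disc (\<lambda>z. (cmod (f z))\<^sup>2)"
    using assms(1) by (intro continuous_intros holomorphic_on_imp_continuous_on)
  then have "set_integrable lebesgue unit_disc (\<lambda>z. (cmod (f z))\<^sup>2 * \<omega> (cmod z))"
    using assms(2) by (intro set_integrable_bounded_mult[OF integrable_weight_disc, where K = "K\<^sup>2"]) (auto intro: power_mono)
  then show ?thesis using assms(1) by (simp add: bergman_space_def)
qed

text \<open>On the smaller disc of radius \<open>\<rho>\<close> the Taylor series converges absolutely and uniformly, so it may
  be integrated term by term; orthogonality of the monomials leaves only the term of index \<open>n\<close>.\<close>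
lemma taylor_coefficient_truncated:
  assumes f: "f holomorphic_on unit_disc" and \<rho>: "0 < \<rho>" "\<rho> < 1"
  shows "(LINT z:unit_disc|lebesgue. f z * cnj z ^ n * of_real (indicator {..\<rho>} (cmod z) * \<omega> (cmod z))) =
     taylor f n * of_real (2 * pi * (LINT r:{0..<1}|lebesgue. r ^ (2 * n + 1) * (indicator {..\<rho>} r * \<omega> r)))"
proof -
  define F where "F = (\<lambda>r. indicator {..\<rho>} r * \<omega> r)"
  define g where "g = (\<lambda>m z. indicator unit_disc z *\<^sub>R (taylor f m * z ^ m * cnj z ^ n * of_real (F (cmod z))))"
  have Fi: "set_integrable lebesgue {0..<1} (\<lambda>r. r ^ k * F r)" for k
    using integrable_mult_indicator[OF _ integrable_moment[of k, unfolded set_integrable_def], of "{..\<rho>}"]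
    by (simp add: set_integrable_def F_def mult_ac)
  have Fm: "set_borel_measurable lebesgue {0..<1} F"
    using Fi[of 0] by (simp add: set_borel_measurable_def set_integrable_def)
  have Fd: "set_integrable lebesgue unit_disc (\<lambda>z. F (cmod z))"
    using Fi[of 1] Fm by (intro radial_set_integral) auto
  have Fdc: "set_integrable lebesgue unit_disc (\<lambda>z. of_real (F (cmod z)) :: complex)"
    using Fd by (simp add: set_integrable_def scaleR_conv_of_real flip: of_real_mult)
  have gi: "integrable lebesgue (g m)" for m
    unfolding g_def set_integrable_def[symmetric]
  proof (rule set_integrable_bounded_mult[OF Fdc])
    fix z :: complex assume "z \<in> unit_disc"
    then have "cmod z ^ m * cmod z ^ n \<le> 1" by (intro mult_le_one power_le_one) auto
    then show "cmod (taylor f m * z ^ m * cnj z ^ n) \<le> cmod (taylor f m)"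
      by (simp add: norm_mult norm_power mult.assoc mult_left_le)
  qed (auto intro!: continuous_intros)
  have gn: "norm (g m z) \<le> norm (taylor f m * \<rho> ^ m) * (indicator unit_disc z *\<^sub>R F (cmod z))" for m z
  proof (cases "z \<in> unit_disc \<and> cmod z \<le> \<rho>")
    case True
    then have "0 \<le> F (cmod z)" by (auto simp: F_def intro: nonneg)
    moreover have "cmod z ^ m * cmod z ^ n \<le> \<rho> ^ m * 1"
      using True \<rho> by (intro mult_mono power_mono power_le_one) auto
    ultimately have "cmod (taylor f m) * (cmod z ^ m * cmod z ^ n) * F (cmod z) \<le> cmod (taylor f m) * (\<rho> ^ m * 1) * F (cmod z)"
      by (intro mult_right_mono mult_left_mono) auto
    then show ?thesis using True \<open>0 \<le> F (cmod z)\<close> \<rho> by (auto simp: g_def norm_mult norm_power mult_ac)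
  qed (auto simp: g_def F_def)
  have sm: "summable (\<lambda>m. norm (taylor f m * \<rho> ^ m))"
  proof -
    obtain \<sigma> where \<sigma>: "\<rho> < \<sigma>" "\<sigma> < 1" using dense \<rho>(2) by blast
    have "summable (\<lambda>m. taylor f m * of_real \<sigma> ^ m)"
      using \<sigma> \<rho> by (intro sums_summable[OF taylor_sums[OF f]]) auto
    from powser_insidea[OF this, of "of_real \<rho>"] show ?thesis using \<sigma> \<rho> by simp
  qed
  have s: "(\<lambda>m. g m z) sums (indicator unit_disc z *\<^sub>R (f z * cnj z ^ n * of_real (F (cmod z))))" for z
    unfolding g_def by (cases "z \<in> unit_disc") (auto intro!: sums_mult2 taylor_sums[OF f])
  have "(\<lambda>m. integral\<^sup>L lebesgue (g m)) sums (\<integral>z. (\<Sum>m. g m z) \<partial>lebesgue)"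
  proof (rule sums_integral[OF gi])
    show "AE z in lebesgue. summable (\<lambda>m. norm (g m z))"
      by (intro AE_I2 summable_comparison_test'[OF summable_mult2[OF sm]]) (use gn in auto)
    have "(\<integral>z. norm (g m z) \<partial>lebesgue) \<le> norm (taylor f m * \<rho> ^ m) * (LINT z:unit_disc|lebesgue. F (cmod z))" for m
      unfolding set_lebesgue_integral_def using Fd
      by (subst integral_mult_right_zero[symmetric], intro integral_mono gn integrable_norm gi)
         (auto simp: set_integrable_def)
    then show "summable (\<lambda>m. \<integral>z. norm (g m z) \<partial>lebesgue)"
      by (intro summable_comparison_test'[OF summable_mult2[OF sm], where N = 0]) auto
  qed
  then have total: "(\<lambda>m. integral\<^sup>L lebesgue (g m)) sums (LINT z:unit_disc|lebesgue. f z * cnj z ^ n * of_real (F (cmod z)))"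
    using s by (simp add: sums_iff set_lebesgue_integral_def)
  have gm: "integral\<^sup>L lebesgue (g m) = taylor f m * (LINT z:unit_disc|lebesgue. z ^ m * cnj z ^ n * of_real (F (cmod z)))" for m
    unfolding set_lebesgue_integral_def g_def by (subst integral_mult_right_zero[symmetric]) (simp add: mult_ac)
  have diagonal: "(LINT z:unit_disc|lebesgue. z ^ n * cnj z ^ n * of_real (F (cmod z)))
      = of_real (2 * pi * (LINT r:{0..<1}|lebesgue. r ^ (2 * n + 1) * F r))"
  proof -
    have cnj: "z * cnj z = (of_real (cmod z))\<^sup>2" for z
      by (metis complex_norm_square of_real_power)
    have "(LINT z:unit_disc|lebesgue. z ^ n * cnj z ^ n * of_real (F (cmod z))) = 
       (LINT z:unit_disc|lebesgue. of_real (cmod z ^ (2 * n) * F (cmod z)))"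
      by (simp add: cnj power_mult flip: power_mult_distrib)
    also have "\<dots> = of_real (LINT z:unit_disc|lebesgue. cmod z ^ (2 * n) * F (cmod z))"
      by (rule set_integral_complex_of_real)
    also have "(LINT z:unit_disc|lebesgue. cmod z ^ (2 * n) * F (cmod z)) = 2 * pi * (LINT r:{0..<1}|lebesgue. r * (r ^ (2 * n) * F r))"
      using Fi[of "2 * n + 1"] Fi[of "2 * n"]
      by (intro radial_set_integral(2)[where F = "\<lambda>r. r ^ (2 * n) * F r"]) (auto simp: mult_ac set_integrable_def set_borel_measurable_def)
    finally show ?thesis by (simp add: mult_ac)
  qed
  have zero: "integral\<^sup>L lebesgue (g m) = 0" if "m \<noteq> n" for m
    using disc_monomial_orthogonal[OF Fm that] by (simp add: gm)
  have "(\<lambda>m. integral\<^sup>L lebesgue (g m)) sums (integral\<^sup>L lebesgue (g n))"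
    using sums_finite[of "{n}", OF _ zero] by simp
  then have "(LINT z:unit_disc|lebesgue. f z * cnj z ^ n * of_real (F (cmod z))) = integral\<^sup>L lebesgue (g n)"
    by (rule sums_unique2[OF total])
  then show ?thesis by (simp only: gm diagonal F_def[symmetric]) (simp only: F_def)
qed

text \<open>Let \<open>\<rho>\<close> tend to 1 in the truncated formula; the integrands are dominated by \<open>\<bar>f\<bar>\<close> times the
  weight, which is integrable.\<close>
lemma taylor_coefficient_integral:
  assumes f: "f \<in> bergman_space \<omega>"
  shows "(LINT z:unit_disc|lebesgue. f z * cnj z ^ n * of_real (\<omega> (cmod z))) =
     taylor f n * of_real (2 * pi * moment \<omega> (2 * n + 1))"
proof -
  have hol: "f holomorphic_on unit_disc" using f by (simp add: bergman_space_def)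
  define \<rho> :: "nat \<Rightarrow> real" where "\<rho> = (\<lambda>k. 1 - 1 / (real k + 2))"
  have \<rho>: "0 < \<rho> k" "\<rho> k < 1" for k by (auto simp: \<rho>_def field_simps)
  have lim: "\<rho> \<longlonglongrightarrow> 1" unfolding \<rho>_def by real_asymp
  have ev: "(\<lambda>k. indicator {..\<rho> k} r :: real) \<longlonglongrightarrow> 1" if "r < 1" for r
  proof -
    have "eventually (\<lambda>k. r < \<rho> k) sequentially" using order_tendstoD(1)[OF lim that] .
    then show ?thesis by (intro tendsto_eventually) (auto elim!: eventually_mono)
  qed
  note int = bergman_integrable_mult_cnj_power[OF f, of n]
  have "(\<lambda>k. LINT z:unit_disc|lebesgue. f z * cnj z ^ n * of_real (indicator {..\<rho> k} (cmod z) * \<omega> (cmod z)))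
      \<longlonglongrightarrow> (LINT z:unit_disc|lebesgue. f z * cnj z ^ n * of_real (\<omega> (cmod z)))"
    unfolding set_lebesgue_integral_def
  proof (rule integral_dominated_convergence)
    show "integrable lebesgue (\<lambda>z. norm (indicator unit_disc z *\<^sub>R (f z * cnj z ^ n * of_real (\<omega> (cmod z)))))"
      using int unfolding set_integrable_def by (rule integrable_norm)
    show "(\<lambda>z. indicator unit_disc z *\<^sub>R (f z * cnj z ^ n * of_real (\<omega> (cmod z)))) \<in> borel_measurable lebesgue"
      using int unfolding set_integrable_def by (rule borel_measurable_integrable)
    show "(\<lambda>z. indicator unit_disc z *\<^sub>R (f z * cnj z ^ n * of_real (indicator {..\<rho> k} (cmod z) * \<omega> (cmod z)))) \<in> borel_measurable lebesgue" for k
    proof -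
      have "{z. cmod z \<le> \<rho> k} \<in> sets lebesgue"
        using lmeasurable_cball[of 0 "\<rho> k"] by (simp add: cball_def fmeasurableD)
      then have "(\<lambda>z. indicator {z. cmod z \<le> \<rho> k} z *\<^sub>R (indicator unit_disc z *\<^sub>R (f z * cnj z ^ n * of_real (\<omega> (cmod z))))) \<in> borel_measurable lebesgue"
        using int unfolding set_integrable_def by (intro borel_measurable_scaleR borel_measurable_indicator borel_measurable_integrable)
      also have "(\<lambda>z. indicator {z. cmod z \<le> \<rho> k} z *\<^sub>R (indicator unit_disc z *\<^sub>R (f z * cnj z ^ n * of_real (\<omega> (cmod z))))) =
          (\<lambda>z. indicator unit_disc z *\<^sub>R (f z * cnj z ^ n * of_real (indicator {..\<rho> k} (cmod z) * \<omega> (cmod z))))"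
        by (auto simp: indicator_def)
      finally show ?thesis .
    qed
    show "AE z in lebesgue. (\<lambda>k. indicator unit_disc z *\<^sub>R (f z * cnj z ^ n * of_real (indicator {..\<rho> k} (cmod z) * \<omega> (cmod z))))
        \<longlonglongrightarrow> indicator unit_disc z *\<^sub>R (f z * cnj z ^ n * of_real (\<omega> (cmod z)))"
    proof (rule AE_I2)
      fix z :: complex
      show "(\<lambda>k. indicator unit_disc z *\<^sub>R (f z * cnj z ^ n * of_real (indicator {..\<rho> k} (cmod z) * \<omega> (cmod z))))
        \<longlonglongrightarrow> indicator unit_disc z *\<^sub>R (f z * cnj z ^ n * of_real (\<omega> (cmod z)))"
      proof (cases "z \<in> unit_disc")
        case True
        then have "(\<lambda>k. indicator unit_disc z *\<^sub>R (f z * cnj z ^ n * of_real (indicator {..\<rho> k} (cmod z) * \<omega> (cmod z))))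
          \<longlonglongrightarrow> indicator unit_disc z *\<^sub>R (f z * cnj z ^ n * of_real (1 * \<omega> (cmod z)))"
          by (intro tendsto_intros ev) auto
        then show ?thesis by simp
      qed auto
    qed
    show "AE z in lebesgue. norm (indicator unit_disc z *\<^sub>R (f z * cnj z ^ n * of_real (indicator {..\<rho> k} (cmod z) * \<omega> (cmod z))))
        \<le> norm (indicator unit_disc z *\<^sub>R (f z * cnj z ^ n * of_real (\<omega> (cmod z))))" for k
      by (auto simp: indicator_def)
  qed
  moreover have "(\<lambda>k. LINT r:{0..<1}|lebesgue. r ^ (2 * n + 1) * (indicator {..\<rho> k} r * \<omega> r)) \<longlonglongrightarrow> moment \<omega> (2 * n + 1)"
    unfolding set_lebesgue_integral_def moment_def
  proof (rule integral_dominated_convergence)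
    note int = integrable_moment[of "2 * n + 1", unfolded set_integrable_def]
    show "integrable lebesgue (\<lambda>r. indicator {0..<1} r *\<^sub>R (r ^ (2 * n + 1) * \<omega> r))" by (rule int)
    then show "(\<lambda>r. indicator {0..<1} r *\<^sub>R (r ^ (2 * n + 1) * \<omega> r)) \<in> borel_measurable lebesgue" by simp
    show "(\<lambda>r. indicator {0..<1} r *\<^sub>R (r ^ (2 * n + 1) * (indicator {..\<rho> k} r * \<omega> r))) \<in> borel_measurable lebesgue" for k
      using borel_measurable_integrable[OF integrable_mult_indicator[OF _ int, of "{..\<rho> k}"]] by (simp add: mult_ac)
    show "AE r in lebesgue. (\<lambda>k. indicator {0..<1} r *\<^sub>R (r ^ (2 * n + 1) * (indicator {..\<rho> k} r * \<omega> r)))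
        \<longlonglongrightarrow> indicator {0..<1} r *\<^sub>R (r ^ (2 * n + 1) * \<omega> r)"
    proof (rule AE_I2)
      fix r :: real
      show "(\<lambda>k. indicator {0..<1} r *\<^sub>R (r ^ (2 * n + 1) * (indicator {..\<rho> k} r * \<omega> r)))
        \<longlonglongrightarrow> indicator {0..<1} r *\<^sub>R (r ^ (2 * n + 1) * \<omega> r)"
      proof (cases "r \<in> {0..<1}")
        case True
        then have "(\<lambda>k. indicator {0..<1} r *\<^sub>R (r ^ (2 * n + 1) * (indicator {..\<rho> k} r * \<omega> r)))
          \<longlonglongrightarrow> indicator {0..<1} r *\<^sub>R (r ^ (2 * n + 1) * (1 * \<omega> r))"
          by (intro tendsto_intros ev) auto
        then show ?thesis by simp
      qed auto
    qed
    show "AE r in lebesgue. norm (indicator {0..<1} r *\<^sub>R (r ^ (2 * n + 1) * (indicator {..\<rho> k} r * \<omega> r))) 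
       \<le> indicator {0..<1} r *\<^sub>R (r ^ (2 * n + 1) * \<omega> r)" for k
      by (auto simp: indicator_def intro!: mult_nonneg_nonneg nonneg)
  qed
  then have "(\<lambda>k. taylor f n * of_real (2 * pi * (LINT r:{0..<1}|lebesgue. r ^ (2 * n + 1) * (indicator {..\<rho> k} r * \<omega> r))))
      \<longlonglongrightarrow> taylor f n * of_real (2 * pi * moment \<omega> (2 * n + 1))"
    by (intro tendsto_intros)
  ultimately show ?thesis
    unfolding taylor_coefficient_truncated[OF hol \<rho>] by (rule LIMSEQ_unique)
qed

definition kernel_coeff :: "real \<Rightarrow> nat \<Rightarrow> real" where
  "kernel_coeff t n = t ^ n / (2 * moment \<omega> (2 * n + 1))"

lemma summable_kernel_coeff:
  assumes "0 \<le> t" "t \<le> 1" "0 \<le> x" "x < 1"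
  shows "summable (\<lambda>n. kernel_coeff t n * x ^ n)"
proof -
  have "t * x < 1" using assms by (smt (verit) mult_left_le_one_le)
  then have "summable (\<lambda>n. (1 / 2) * ((t * x) ^ n / moment \<omega> (2 * n + 1)))"
    using assms by (intro summable_mult summable_power_over_moment) auto
  then show ?thesis by (simp add: kernel_coeff_def power_mult_distrib field_simps)
qed

lemma kernel_coeff_nonneg: "0 \<le> t \<Longrightarrow> 0 \<le> kernel_coeff t n"
  using moment_pos[of "2 * n + 1"] by (simp add: kernel_coeff_def)

lemma summable_kernel_coeff_1:
  assumes "0 \<le> t" "t < 1"
  shows "summable (kernel_coeff t)"
  using summable_power_over_moment[OF assms, THEN summable_mult, of "1 / 2"]
  by (simp add: kernel_coeff_def[abs_def])

definition kernel_series :: "real \<Rightarrow> complex \<Rightarrow> complex" where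
  "kernel_series t z = (\<Sum>n. of_real (kernel_coeff t n) * z ^ n)"

lemma kernel_term_norm_le:
  assumes "0 \<le> t" "cmod z \<le> 1"
  shows "cmod (of_real (kernel_coeff t n) * z ^ n) \<le> kernel_coeff t n"
  using kernel_coeff_nonneg[OF assms(1), of n] assms(2)
  by (simp add: norm_mult norm_power mult_left_le power_le_one)

lemma kernel_series_sums:
  assumes "0 \<le> t" "t < 1" "cmod z \<le> 1"
  shows "(\<lambda>n. of_real (kernel_coeff t n) * z ^ n) sums kernel_series t z"
  unfolding kernel_series_def
  by (intro summable_sums summable_comparison_test'[OF summable_kernel_coeff_1[OF assms(1,2)]] kernel_term_norm_le assms)

lemma kernel_series_in_bergman_space:
  assumes t: "0 \<le> t" "t < 1"
  shows "kernel_series t \<in> bergman_space \<omega>"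
proof (rule bounded_holomorphic_in_bergman_space)
  show "kernel_series t holomorphic_on unit_disc"
    by (rule power_series_holomorphic[where a = "\<lambda>n. of_real (kernel_coeff t n)"])
       (use kernel_series_sums[OF t] in auto)
  show "cmod (kernel_series t z) \<le> (\<Sum>n. kernel_coeff t n)" if "z \<in> unit_disc" for z
    unfolding kernel_series_def
    by (rule norm_suminf_le) (use kernel_term_norm_le summable_kernel_coeff_1 that t in auto)
qed

text \<open>For \<open>t < 1\<close> the series of the kernel converges uniformly on the closed disc, so pairing with \<open>f\<close> may be
  done term by term, and each term returns one term of the Taylor expansion of \<open>f\<close> at \<open>t\<close>.\<close>
lemma kernel_series_reproducing:
  assumes t: "0 \<le> t" "t < 1" and f: "f \<in> bergman_space \<omega>"
  shows "f (of_real t) = disc_integral (\<lambda>z. f z * cnj (kernel_series t z) * of_real (\<omega> (cmod z)))"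
proof -
  have hol: "f holomorphic_on unit_disc" using f by (simp add: bergman_space_def)
  define g where "g = (\<lambda>n z. indicator unit_disc z *\<^sub>R (of_real (kernel_coeff t n) * (f z * cnj z ^ n * of_real (\<omega> (cmod z)))))"
  define h where "h = (\<lambda>z. indicator unit_disc z *\<^sub>R (f z * of_real (\<omega> (cmod z))))"
  have h: "integrable lebesgue h" using bergman_integrable[OF f] by (simp add: h_def set_integrable_def)
  have gi: "integrable lebesgue (g n)" for n
  proof -
    have "set_integrable lebesgue unit_disc (\<lambda>z. (of_real (kernel_coeff t n) * cnj z ^ n) * (f z * of_real (\<omega> (cmod z))))"
      using kernel_term_norm_le[OF t(1), of _ n]
      by (intro set_integrable_bounded_mult[OF bergman_integrable[OF f], where K = "kernel_coeff t n"])
         (auto intro!: continuous_intros simp: norm_mult norm_power)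
    then show ?thesis by (simp add: g_def set_integrable_def mult_ac)
  qed
  have gn: "norm (g n z) \<le> kernel_coeff t n * norm (h z)" for n z
  proof -
    have "g n z = (of_real (kernel_coeff t n) * cnj z ^ n) * h z" by (simp add: g_def h_def)
    moreover have "norm (of_real (kernel_coeff t n) * cnj z ^ n) \<le> kernel_coeff t n" if "z \<in> unit_disc"
      using kernel_term_norm_le[OF t(1), of z n] that by (simp add: norm_mult norm_power)
    ultimately show ?thesis
      by (cases "z \<in> unit_disc") (auto simp: norm_mult h_def intro: mult_right_mono)
  qed
  have s: "(\<lambda>n. g n z) sums (indicator unit_disc z *\<^sub>R (f z * cnj (kernel_series t z) * of_real (\<omega> (cmod z))))" for z
  proof (cases "z \<in> unit_disc")
    case True
    then have "(\<lambda>n. cnj (of_real (kernel_coeff t n) * z ^ n)) sums cnj (kernel_series t z)"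
      by (intro sums_cnj[THEN iffD2] kernel_series_sums t) auto
    then have "(\<lambda>n. f z * cnj (of_real (kernel_coeff t n) * z ^ n) * of_real (\<omega> (cmod z))) sums (f z * cnj (kernel_series t z) * of_real (\<omega> (cmod z)))"
      by (intro sums_mult2 sums_mult)
    then show ?thesis using True by (simp add: g_def mult_ac)
  qed (simp add: g_def)
  have "(\<lambda>n. integral\<^sup>L lebesgue (g n)) sums (\<integral>z. (\<Sum>n. g n z) \<partial>lebesgue)"
  proof (rule sums_integral[OF gi])
    show "AE z in lebesgue. summable (\<lambda>n. norm (g n z))"
      by (intro AE_I2 summable_comparison_test'[OF summable_mult2[OF summable_kernel_coeff_1[OF t]]]) (use gn in auto)
    have "(\<integral>z. norm (g n z) \<partial>lebesgue) \<le> kernel_coeff t n * (\<integral>z. norm (h z) \<partial>lebesgue)" for n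
      by (subst integral_mult_right_zero[symmetric], intro integral_mono gn integrable_norm gi integrable_mult_right h)
    then show "summable (\<lambda>n. \<integral>z. norm (g n z) \<partial>lebesgue)"
      by (intro summable_comparison_test'[OF summable_mult2[OF summable_kernel_coeff_1[OF t]], where N = 0]) auto
  qed
  then have "(\<lambda>n. integral\<^sup>L lebesgue (g n)) sums (LINT z:unit_disc|lebesgue. f z * cnj (kernel_series t z) * of_real (\<omega> (cmod z)))"
    using s by (simp add: sums_iff set_lebesgue_integral_def)
  moreover have "integral\<^sup>L lebesgue (g n) = of_real pi * (taylor f n * of_real t ^ n)" for n
  proof -
    have "integral\<^sup>L lebesgue (g n) = of_real (kernel_coeff t n) * (LINT z:unit_disc|lebesgue. f z * cnj z ^ n * of_real (\<omega> (cmod z)))"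
      unfolding set_lebesgue_integral_def g_def by (subst integral_mult_right_zero[symmetric]) (simp add: mult_ac)
    also have "\<dots> = of_real pi * (taylor f n * of_real t ^ n)"
      using moment_pos[of "2 * n + 1"] by (simp add: taylor_coefficient_integral[OF f] kernel_coeff_def)
    finally show ?thesis .
  qed
  moreover have "(\<lambda>n. of_real pi * (taylor f n * of_real t ^ n)) sums (of_real pi * f (of_real t))"
    using t by (intro sums_mult taylor_sums[OF hol]) auto
  ultimately have "(LINT z:unit_disc|lebesgue. f z * cnj (kernel_series t z) * of_real (\<omega> (cmod z))) = of_real pi * f (of_real t)"
    by (simp add: sums_iff)
  then show ?thesis by (simp add: disc_integral_def)
qed

text \<open>Uniqueness of the kernel: testing the reproducing property on the monomials determines its Taylor
  coefficients.\<close>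
lemma bergman_kernel_eq_kernel_series:
  assumes t: "0 \<le> t" "t < 1" and z: "z \<in> unit_disc"
  shows "bergman_kernel \<omega> (of_real t) z = kernel_series t z"
proof -
  define k where "k = bergman_kernel \<omega> (of_real t)"
  have "reproducing_kernel_at \<omega> (of_real t) (kernel_series t)"
    using kernel_series_in_bergman_space kernel_series_reproducing t by (simp add: reproducing_kernel_at_def)
  then have "reproducing_kernel_at \<omega> (of_real t) k"
    unfolding k_def bergman_kernel_def by (rule someI[of "reproducing_kernel_at \<omega> (of_real t)"])
  then have k: "k \<in> bergman_space \<omega>"
    and rep: "\<And>f. f \<in> bergman_space \<omega> \<Longrightarrow> f (of_real t) = disc_integral (\<lambda>z. f z * cnj (k z) * of_real (\<omega> (cmod z)))"
    by (auto simp: reproducing_kernel_at_def)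
  have "taylor k n = of_real (kernel_coeff t n)" for n
  proof -
    have "(\<lambda>z. z ^ n) \<in> bergman_space \<omega>"
      by (rule bounded_holomorphic_in_bergman_space[where K = 1])
         (auto intro!: holomorphic_intros simp: norm_power power_le_one)
    from rep[OF this] have "of_real t ^ n * of_real pi = (LINT z:unit_disc|lebesgue. z ^ n * cnj (k z) * of_real (\<omega> (cmod z)))"
      by (simp add: disc_integral_def)
    also have "\<dots> = (LINT z:unit_disc|lebesgue. cnj (k z * cnj z ^ n * of_real (\<omega> (cmod z))))"
      by (simp add: mult_ac)
    also have "\<dots> = cnj (LINT z:unit_disc|lebesgue. k z * cnj z ^ n * of_real (\<omega> (cmod z)))"
      using integral_bounded_linear[OF bounded_linear_cnj bergman_integrable_mult_cnj_power[OF k, of n, unfolded set_integrable_def]]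
      by (simp add: set_lebesgue_integral_def)
    also have "\<dots> = cnj (taylor k n) * of_real (2 * pi * moment \<omega> (2 * n + 1))"
      by (simp add: taylor_coefficient_integral[OF k])
    finally have "cnj (taylor k n) = of_real t ^ n / of_real (2 * moment \<omega> (2 * n + 1))"
      using moment_pos[of "2 * n + 1"] by (simp add: field_simps)
    then have "cnj (cnj (taylor k n)) = cnj (of_real (kernel_coeff t n))"
      by (simp add: kernel_coeff_def)
    then show ?thesis by simp
  qed
  then have "(\<lambda>n. of_real (kernel_coeff t n) * z ^ n) sums k z"
    using taylor_sums[of k z] k z by (simp add: bergman_space_def)
  then show ?thesis using z kernel_series_sums[OF t, of z] by (simp add: k_def sums_iff)
qed

end

section \<open>The power series of the Hilbert-type operator\<close>

context weight begin

definition hilbert_coeff :: "real \<Rightarrow> nat \<Rightarrow> real" where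
  "hilbert_coeff t n = kernel_coeff t n / (n + 1)"

lemma hilbert_coeff_bounds:
  assumes "0 \<le> t" shows "0 \<le> hilbert_coeff t n" "hilbert_coeff t n \<le> kernel_coeff t n"
  using kernel_coeff_nonneg[OF assms, of n] by (auto simp: hilbert_coeff_def divide_le_eq mult_left_le algebra_simps)

definition hilbert_series :: "real \<Rightarrow> complex \<Rightarrow> complex" where
  "hilbert_series t z = (\<Sum>n. of_real (hilbert_coeff t n) * z ^ n)"

lemma hilbert_series_sums:
  assumes t: "0 \<le> t" "t < 1" and z: "z \<in> unit_disc"
  shows "(\<lambda>n. of_real (hilbert_coeff t n) * z ^ n) sums hilbert_series t z"
  unfolding hilbert_series_def
proof (intro summable_sums summable_comparison_test'[OF summable_kernel_coeff_1[OF t], where N = 0])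
  fix n
  have "hilbert_coeff t n * cmod z ^ n \<le> kernel_coeff t n * 1"
    using z t hilbert_coeff_bounds[OF t(1), of n] kernel_coeff_nonneg[OF t(1), of n]
    by (intro mult_mono power_le_one) auto
  then show "cmod (of_real (hilbert_coeff t n) * z ^ n) \<le> kernel_coeff t n"
    using hilbert_coeff_bounds[OF t(1), of n] by (simp add: norm_mult norm_power)
qed

lemma hilbert_series_primitive:
  assumes t: "0 \<le> t" "t < 1" and z: "z \<in> unit_disc"
  shows "((\<lambda>z. z * hilbert_series t z) has_field_derivative kernel_series t z) (at z)"
proof -
  define c :: "nat \<Rightarrow> complex" where "c = (\<lambda>n. case n of 0 \<Rightarrow> 0 | Suc m \<Rightarrow> of_real (hilbert_coeff t m))"
  have c: "(\<lambda>n. c n * z ^ n) sums (z * hilbert_series t z)" if "cmod z < 1" for z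
  proof -
    have "(\<lambda>n. z * (of_real (hilbert_coeff t n) * z ^ n)) sums (z * hilbert_series t z)"
      by (intro sums_mult hilbert_series_sums t) (use that in auto)
    then have "(\<lambda>n. c (Suc n) * z ^ Suc n) sums (z * hilbert_series t z)"
      by (simp add: c_def mult_ac)
    then show ?thesis by (subst (asm) sums_Suc_iff) (simp add: c_def)
  qed
  have "((\<lambda>z. \<Sum>n. c n * z ^ n) has_field_derivative (\<Sum>n. diffs c n * z ^ n)) (at z)"
    using z by (intro termdiffs_strong'[where K = 1] sums_summable[OF c]) auto
  also have "(\<Sum>n. diffs c n * z ^ n) = kernel_series t z"
    unfolding kernel_series_def
  proof (intro suminf_cong)
    fix n
    have "real (Suc n) * hilbert_coeff t n = kernel_coeff t n"
      by (simp add: hilbert_coeff_def)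
    then have "complex_of_real (real (Suc n) * hilbert_coeff t n) = of_real (kernel_coeff t n)"
      by (rule arg_cong)
    then have "of_nat (Suc n) * complex_of_real (hilbert_coeff t n) = of_real (kernel_coeff t n)"
      by (simp only: of_real_mult of_real_of_nat_eq)
    then show "diffs c n * z ^ n = of_real (kernel_coeff t n) * z ^ n" by (simp add: diffs_def c_def)
  qed
  finally show ?thesis
    by (rule has_field_derivative_transform_within_open[where S = unit_disc])
       (use z c in \<open>auto simp: sums_iff\<close>)
qed

text \<open>The primitive \<open>z * hilbert_series t z\<close> evaluates the line integral away from the origin; at the origin
  continuity of the series identifies the removed singularity.\<close>
lemma hilbert_coeff_sums_kernel:
  assumes t: "0 \<le> t" "t < 1" and z: "z \<in> unit_disc"
  shows "(\<lambda>n. of_real (hilbert_coeff t n) * z ^ n) sums hilbert_kernel \<omega> t z"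
proof -
  define q where "q = hilbert_series t"
  have "q holomorphic_on unit_disc"
    by (rule power_series_holomorphic[where a = "\<lambda>n. of_real (hilbert_coeff t n)"])
       (use hilbert_series_sums[OF t] in \<open>auto simp: q_def\<close>)
  then have "isCont q z"
    using z by (metis continuous_on_eq_continuous_at holomorphic_on_imp_continuous_on open_ball)
  have eq: "1 / w * contour_integral (linepath 0 w) (bergman_kernel \<omega> (of_real t)) = q w"
    if "w \<in> unit_disc" "w \<noteq> 0" for w
  proof -
    have seg: "closed_segment 0 w \<subseteq> unit_disc"
      using that by (intro closed_segment_subset) auto
    have "(kernel_series t has_contour_integral (pathfinish (linepath 0 w) * q (pathfinish (linepath 0 w)) - pathstart (linepath 0 w) * q (pathstart (linepath 0 w)))) (linepath 0 w)"
      unfolding q_def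
      by (rule contour_integral_primitive[where S = unit_disc])
         (use seg in \<open>auto intro: has_field_derivative_at_within[OF hilbert_series_primitive[OF t]] simp del: linepath_0\<close>)
    then have "(kernel_series t has_contour_integral w * q w) (linepath 0 w)" by simp
    then have "(bergman_kernel \<omega> (of_real t) has_contour_integral w * q w) (linepath 0 w)"
      by (rule has_contour_integral_eq) (use seg bergman_kernel_eq_kernel_series[OF t] in auto)
    then show ?thesis using that by (simp add: contour_integral_unique)
  qed
  have "hilbert_kernel \<omega> t z = q z"
    unfolding hilbert_kernel_def
  proof (rule remove_sings_eqI)
    have "eventually (\<lambda>w. w \<in> unit_disc - {z} \<and> w \<noteq> 0) (at z)"
      using z by (intro eventually_conj eventually_at_in_open eventually_neq_at_within) auto
    then have ev: "eventually (\<lambda>w. q w = 1 / w * contour_integral (linepath 0 w) (bergman_kernel \<omega> (of_real t))) (at z)"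
      by eventually_elim (use eq in auto)
    have "q \<midarrow>z\<rightarrow> q z" using \<open>isCont q z\<close> by (simp add: isCont_def)
    then show "(\<lambda>w. 1 / w * contour_integral (linepath 0 w) (bergman_kernel \<omega> (of_real t))) \<midarrow>z\<rightarrow> q z"
      by (rule Lim_transform_eventually[OF _ ev])
  qed
  then show ?thesis using hilbert_series_sums[OF t z] by (simp add: q_def)
qed

definition hilbert_op_coeff :: "(complex \<Rightarrow> complex) \<Rightarrow> nat \<Rightarrow> complex" where
  "hilbert_op_coeff f n = (LINT t:{0..<1}|lebesgue. f (of_real t) * of_real (t ^ n * \<omega> t)) / of_real (2 * real (n + 1) * moment \<omega> (2 * n + 1))"

context
  fixes f :: "complex \<Rightarrow> complex" and K :: real
  assumes f: "f holomorphic_on unit_disc" and K: "\<And>z. z \<in> unit_disc \<Longrightarrow> cmod (f z) \<le> K"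
begin

lemma integrable_f_moment:
  "set_integrable lebesgue {0..<1} (\<lambda>t. f (of_real t) * of_real (t ^ n * \<omega> t))"
proof (rule set_integrable_bounded_mult)
  show "set_integrable lebesgue {0..<1} (\<lambda>t. of_real (t ^ n * \<omega> t) :: complex)"
    using integrable_of_real[OF integrable_moment[of n, unfolded set_integrable_def], where 'a = complex]
    by (simp add: set_integrable_def scaleR_conv_of_real)
  show "continuous_on {0..<1} (\<lambda>t. f (of_real t))"
    by (rule continuous_on_compose2[OF holomorphic_on_imp_continuous_on[OF f]]) (auto intro!: continuous_intros)
  show "cmod (f (of_real t)) \<le> K" if "t \<in> {0..<1}" for t using that by (intro K) auto
qed auto

lemma hilbert_op_coeff_bound:
  "cmod (hilbert_op_coeff f n) \<le> K * (moment \<omega> n / (2 * real (n + 1) * moment \<omega> (2 * n + 1)))"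
proof -
  have "cmod (LINT t:{0..<1}|lebesgue. f (of_real t) * of_real (t ^ n * \<omega> t)) \<le> 
     (LINT t:{0..<1}|lebesgue. cmod (f (of_real t) * of_real (t ^ n * \<omega> t)))"
    by (rule set_integral_norm_bound[OF integrable_f_moment])
  also have "\<dots> \<le> (LINT t:{0..<1}|lebesgue. K * (t ^ n * \<omega> t))"
    by (intro set_integral_mono set_integrable_norm integrable_f_moment set_integrable_mult_right integrable_moment)
       (auto simp: norm_mult norm_power nonneg intro!: mult_right_mono K)
  also have "\<dots> = K * moment \<omega> n" by (simp add: moment_def)
  finally have "cmod (hilbert_op_coeff f n) \<le> K * moment \<omega> n / cmod (of_real (2 * real (n + 1) * moment \<omega> (2 * n + 1)))"
    unfolding hilbert_op_coeff_def norm_divide by (rule divide_right_mono) simp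
  also have "\<dots> = K * (moment \<omega> n / (2 * real (n + 1) * moment \<omega> (2 * n + 1)))"
    using moment_pos[of "2 * n + 1"] unfolding norm_of_real by (subst abs_of_nonneg) auto
  finally show ?thesis .
qed

text \<open>Integration in \<open>t\<close> and summation commute since the terms are dominated by the convergent series of
  \<open>kernel_coeff 1 n * \<bar>z\<bar> ^ n\<close>, with \<open>t = 1\<close> the worst case.\<close>
lemma hilbert_op_sums:
  assumes z: "z \<in> unit_disc"
  shows "(\<lambda>n. hilbert_op_coeff f n * z ^ n) sums hilbert_op \<omega> f z"
proof -
  define g where "g = (\<lambda>n t. indicator {0..<1} t *\<^sub>R (of_real (hilbert_coeff 1 n) * z ^ n * (f (of_real t) * of_real (t ^ n * \<omega> t))))"
  have gi: "integrable lebesgue (g n)" for n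
    using set_integrable_mult_right[OF integrable_f_moment, of "of_real (hilbert_coeff 1 n) * z ^ n" n]
    by (simp add: g_def set_integrable_def)
  have K0: "0 \<le> K" using K[of 0] norm_ge_zero[of "f 0"] by (simp del: norm_ge_zero)
  have gn: "norm (g n t) \<le> (kernel_coeff 1 n * cmod z ^ n) * (indicator {0..<1} t *\<^sub>R (K * \<omega> t))" for n t
  proof (cases "t \<in> {0..<1}")
    case True
    have 1: "cmod (f (of_real t)) * (t ^ n * \<omega> t) \<le> K * (1 * \<omega> t)"
      using True K0 by (intro mult_mono K power_le_one nonneg mult_nonneg_nonneg) auto
    have 2: "hilbert_coeff 1 n * cmod z ^ n \<le> kernel_coeff 1 n * cmod z ^ n"
      by (intro mult_right_mono hilbert_coeff_bounds) auto
    have "0 \<le> kernel_coeff 1 n * cmod z ^ n" "0 \<le> cmod (f (of_real t)) * (t ^ n * \<omega> t)"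
      using True nonneg[of t] kernel_coeff_nonneg[of 1 n] by simp_all
    note mult_mono[OF 2 1 this]
    then show ?thesis
      using True nonneg[of t] hilbert_coeff_bounds(1)[of 1 n] by (simp add: g_def norm_mult norm_power)
  qed (simp add: g_def)
  have sm: "summable (\<lambda>n. kernel_coeff 1 n * cmod z ^ n)"
    using z by (intro summable_kernel_coeff) auto
  have iw: "integrable lebesgue (\<lambda>t. indicator {0..<1} t *\<^sub>R (K * \<omega> t))"
    using set_integrable_mult_right[OF integrable_weight, of K] by (simp add: set_integrable_def)
  have s: "(\<lambda>n. g n t) sums (indicator {0..<1} t *\<^sub>R (f (of_real t) * hilbert_kernel \<omega> t z * of_real (\<omega> t)))" for t
  proof (cases "t \<in> {0..<1}")
    case True
    then have "(\<lambda>n. f (of_real t) * (of_real (hilbert_coeff t n) * z ^ n) * of_real (\<omega> t)) sums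
        (f (of_real t) * hilbert_kernel \<omega> t z * of_real (\<omega> t))"
      using z by (intro sums_mult2 sums_mult hilbert_coeff_sums_kernel) auto
    then show ?thesis using True by (simp add: g_def hilbert_coeff_def kernel_coeff_def mult_ac)
  qed (simp add: g_def)
  have "(\<lambda>n. integral\<^sup>L lebesgue (g n)) sums (\<integral>t. (\<Sum>n. g n t) \<partial>lebesgue)"
  proof (rule sums_integral[OF gi])
    show "AE t in lebesgue. summable (\<lambda>n. norm (g n t))"
      by (intro AE_I2 summable_comparison_test'[OF summable_mult2[OF sm]]) (use gn in auto)
    have "(\<integral>t. norm (g n t) \<partial>lebesgue) \<le> (kernel_coeff 1 n * cmod z ^ n) * (\<integral>t. indicator {0..<1} t *\<^sub>R (K * \<omega> t) \<partial>lebesgue)" for n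
      by (subst integral_mult_right_zero[symmetric], intro integral_mono gn integrable_norm gi integrable_mult_right iw)
    then show "summable (\<lambda>n. \<integral>t. norm (g n t) \<partial>lebesgue)"
      by (intro summable_comparison_test'[OF summable_mult2[OF sm], where N = 0]) auto
  qed
  then have "(\<lambda>n. integral\<^sup>L lebesgue (g n)) sums hilbert_op \<omega> f z"
    using s by (simp add: sums_iff set_lebesgue_integral_def hilbert_op_def)
  moreover have "integral\<^sup>L lebesgue (g n) = hilbert_op_coeff f n * z ^ n" for n
  proof -
    have "integral\<^sup>L lebesgue (g n) = of_real (hilbert_coeff 1 n) * z ^ n * (LINT t:{0..<1}|lebesgue. f (of_real t) * of_real (t ^ n * \<omega> t))"
      unfolding set_lebesgue_integral_def g_def by (subst integral_mult_right_zero[symmetric]) (simp add: mult_ac)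
    then show ?thesis by (simp add: hilbert_op_coeff_def hilbert_coeff_def kernel_coeff_def field_simps)
  qed
  ultimately show ?thesis by simp
qed

lemma hilbert_op_holomorphic: "hilbert_op \<omega> f holomorphic_on unit_disc"
  by (rule power_series_holomorphic[where a = "hilbert_op_coeff f"]) (use hilbert_op_sums in auto)

lemma hilbert_op_at_0: "hilbert_op \<omega> f 0 = hilbert_op_coeff f 0"
  using sums_unique2[OF hilbert_op_sums[of 0] powser_sums_zero] by simp

lemma hilbert_op_deriv_sums:
  assumes "z \<in> unit_disc"
  shows "(\<lambda>n. diffs (hilbert_op_coeff f) n * z ^ n) sums deriv (hilbert_op \<omega> f) z"
proof (rule termdiffs_sums_strong[where K = 1 and f = "hilbert_op \<omega> f"])
  show "(hilbert_op \<omega> f has_field_derivative deriv (hilbert_op \<omega> f) z) (at z)"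
    by (rule holomorphic_derivI[OF hilbert_op_holomorphic open_ball assms])
qed (use assms hilbert_op_sums in auto)

end
end

section \<open>Doubling of tails and doubling of moments\<close>

context weight begin

lemma tail_antimono:
  assumes "0 \<le> r" "r \<le> s"
  shows "weight_tail \<omega> s \<le> weight_tail \<omega> r"
  unfolding weight_tail_def set_lebesgue_integral_def
  using set_integrable_subset[OF integrable_weight, of "{r..<1}"] set_integrable_subset[OF integrable_weight, of "{s..<1}"] assms
  by (intro integral_mono) (auto simp: set_integrable_def indicator_def intro!: nonneg)

text \<open>Fubini's theorem is applied to the weight below, so moments and tails are first expressed through
  one Borel function with values in the extended half-line.\<close>
lemma weight_representative:
  obtains w :: "real \<Rightarrow> ennreal" where "w \<in> borel_measurable borel"
    "\<And>n. ennreal (moment \<omega> n) = (\<integral>\<^sup>+t. ennreal (t ^ n) * w t \<partial>lborel)"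
    "\<And>r. 0 \<le> r \<Longrightarrow> ennreal (weight_tail \<omega> r) = (\<integral>\<^sup>+t. indicator {r..} t * w t \<partial>lborel)"
    "\<And>t. \<not> 0 \<le> t \<Longrightarrow> w t = 0"
proof -
  have "set_borel_measurable lebesgue {0..<1} \<omega>"
    using integrable_weight by (simp add: set_borel_measurable_def set_integrable_def)
  then obtain G where [measurable]: "G \<in> borel_measurable borel" and ae: "AE t in lborel. t \<in> {0..<1} \<longrightarrow> \<omega> t = G t"
    by (rule borel_representative)
  define w where "w = (\<lambda>t. ennreal (indicator {0..<1} t * G t))"
  have eq: "ennreal (LINT t:{0..<1}|lebesgue. g t * \<omega> t) = (\<integral>\<^sup>+t. ennreal (g t) * w t \<partial>lborel)"
    if int: "set_integrable lebesgue {0..<1} (\<lambda>t. g t * \<omega> t)" and g: "\<And>t. 0 \<le> t \<Longrightarrow> t < 1 \<Longrightarrow> 0 \<le> g t" for g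
  proof -
    have "ennreal (LINT t:{0..<1}|lebesgue. g t * \<omega> t) = (\<integral>\<^sup>+t. ennreal (indicator {0..<1} t *\<^sub>R (g t * \<omega> t)) \<partial>lebesgue)"
      unfolding set_lebesgue_integral_def
      by (rule nn_integral_eq_integral[symmetric, OF int[unfolded set_integrable_def]])
         (auto simp: indicator_def intro!: mult_nonneg_nonneg g nonneg)
    also have "\<dots> = (\<integral>\<^sup>+t. ennreal (g t) * w t \<partial>lebesgue)"
      using AE_completion[OF ae]
      by (intro nn_integral_cong_AE) (auto elim!: eventually_mono simp: w_def indicator_def ennreal_mult' g)
    finally show ?thesis by (simp add: nn_integral_completion)
  qed
  show thesis
  proof
    show "w \<in> borel_measurable borel" unfolding w_def by measurable
    show "w t = 0" if "\<not> 0 \<le> t" for t using that by (simp add: w_def)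
    show "ennreal (moment \<omega> n) = (\<integral>\<^sup>+t. ennreal (t ^ n) * w t \<partial>lborel)" for n
      unfolding moment_def by (rule eq[OF integrable_moment]) auto
    show "ennreal (weight_tail \<omega> r) = (\<integral>\<^sup>+t. indicator {r..} t * w t \<partial>lborel)" if "0 \<le> r" for r
    proof -
      have "weight_tail \<omega> r = (LINT t:{0..<1}|lebesgue. indicator {r..} t * \<omega> t)"
        unfolding weight_tail_def set_lebesgue_integral_def using that
        by (intro Bochner_Integration.integral_cong) (auto simp: indicator_def)
      moreover have "set_integrable lebesgue {0..<1} (\<lambda>t. indicator {r..} t * \<omega> t)"
        using integrable_mult_indicator[OF _ integrable_weight[unfolded set_integrable_def], of "{r..}"]
        by (simp add: set_integrable_def mult_ac)
      ultimately show ?thesis by (simp add: eq ennreal_indicator)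
    qed
  qed
qed

text \<open>Layer cake: \<open>moment \<omega> (n + 1)\<close> is the integral of \<open>(n + 1) * x ^ n * weight_tail \<omega> x\<close> over \<open>[0,1)\<close>.
  The doubling condition replaces the tail at \<open>x\<close> by the tail at \<open>y = (1 + x) / 2\<close>, and
  \<open>x \<le> y\<^sup>2\<close> turns \<open>x ^ n\<close> into \<open>y ^ (2 * n)\<close>. The factor 2 comes from substituting \<open>y\<close> for \<open>x\<close>.\<close>
lemma moment_le_moment_of_D_hat:
  assumes C: "0 \<le> C" "\<And>r. 0 \<le> r \<Longrightarrow> r < 1 \<Longrightarrow> weight_tail \<omega> r \<le> C * weight_tail \<omega> ((1 + r) / 2)"
  shows "moment \<omega> (Suc n) \<le> 2 * C * moment \<omega> (2 * n + 1)"
proof -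
  obtain w :: "real \<Rightarrow> ennreal" where w [measurable]: "w \<in> borel_measurable borel"
    and mom: "\<And>n. ennreal (moment \<omega> n) = (\<integral>\<^sup>+t. ennreal (t ^ n) * w t \<partial>lborel)"
    and tail: "\<And>r. 0 \<le> r \<Longrightarrow> ennreal (weight_tail \<omega> r) = (\<integral>\<^sup>+t. indicator {r..} t * w t \<partial>lborel)"
    and w0: "\<And>t. \<not> 0 \<le> t \<Longrightarrow> w t = 0"
    using weight_representative by blast
  define h where "h = (\<lambda>n x. ennreal (real (Suc n) * x ^ n) * indicator {0..<1} x * ennreal (weight_tail \<omega> x))"
  define T where "T = (\<lambda>x. \<integral>\<^sup>+t. (if x \<le> t then 1 else 0) * w t \<partial>lborel)"
  have [measurable]: "T \<in> borel_measurable borel" unfolding T_def by measurable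
  have T: "T x = ennreal (weight_tail \<omega> x)" if "0 \<le> x" for x
    unfolding T_def tail[OF that] by (intro nn_integral_cong) (auto simp: indicator_def)
  have "h n = (\<lambda>x. ennreal (real (Suc n) * x ^ n) * indicator {0..<1} x * T x)" for n
    by (auto simp: h_def T indicator_def)
  then have hm [measurable]: "h n \<in> borel_measurable borel" for n by simp
  have cake: "ennreal (moment \<omega> (Suc n)) = (\<integral>\<^sup>+x. h n x \<partial>lborel)" for n
  proof -
    have "ennreal (moment \<omega> (Suc n)) = (\<integral>\<^sup>+t. (\<integral>\<^sup>+x. ennreal (real (Suc n) * x ^ n) * (if 0 \<le> x \<and> x \<le> t then 1 else 0) * w t \<partial>lborel) \<partial>lborel)"
      unfolding mom
    proof (intro nn_integral_cong)
      fix t :: real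
      show "ennreal (t ^ Suc n) * w t = (\<integral>\<^sup>+x. ennreal (real (Suc n) * x ^ n) * (if 0 \<le> x \<and> x \<le> t then 1 else 0) * w t \<partial>lborel)"
      proof (cases "0 \<le> t")
        case True
        have "(\<integral>\<^sup>+x. ennreal (real (Suc n) * x ^ n) * indicator {0..t} x \<partial>lborel) = ennreal (t ^ Suc n - 0 ^ Suc n)"
          by (rule nn_integral_FTC_Icc) (use True DERIV_pow[of "Suc n"] in \<open>auto simp del: power_Suc\<close>)
        then have "ennreal (t ^ Suc n) * w t = (\<integral>\<^sup>+x. ennreal (real (Suc n) * x ^ n) * indicator {0..t} x * w t \<partial>lborel)"
          by (subst nn_integral_multc) auto
        also have "\<dots> = (\<integral>\<^sup>+x. ennreal (real (Suc n) * x ^ n) * (if 0 \<le> x \<and> x \<le> t then 1 else 0) * w t \<partial>lborel)"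
          by (intro nn_integral_cong) (auto simp: indicator_def)
        finally show ?thesis .
      next
        case False
        then have "w t = 0" by (rule w0)
        then show ?thesis by simp
      qed
    qed
    also have "\<dots> = (\<integral>\<^sup>+x. (\<integral>\<^sup>+t. ennreal (real (Suc n) * x ^ n) * (if 0 \<le> x \<and> x \<le> t then 1 else 0) * w t \<partial>lborel) \<partial>lborel)"
      by (rule lborel_pair.Fubini') measurable
    also have "\<dots> = (\<integral>\<^sup>+x. ennreal (real (Suc n) * x ^ n) * indicator {0..} x * T x \<partial>lborel)"
      unfolding T_def
      by (intro nn_integral_cong) (auto simp: indicator_def nn_integral_cmult[symmetric] mult_ac intro!: nn_integral_cong)
    also have "\<dots> = (\<integral>\<^sup>+x. h n x \<partial>lborel)"
    proof (intro nn_integral_cong)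
      fix x :: real
      have "weight_tail \<omega> x = 0" if "1 \<le> x" using that by (simp add: weight_tail_def set_lebesgue_integral_def)
      then show "ennreal (real (Suc n) * x ^ n) * indicator {0..} x * T x = h n x"
        by (cases "x < 1") (auto simp: h_def T indicator_def)
    qed
    finally show ?thesis .
  qed
  have "ennreal (moment \<omega> (Suc n)) = (\<integral>\<^sup>+x. h n x \<partial>lborel)" by (rule cake)
  also have "\<dots> \<le> (\<integral>\<^sup>+x. ennreal C * h (2 * n) (1 / 2 + 1 / 2 * x) \<partial>lborel)"
  proof (rule nn_integral_mono)
    fix x :: real
    show "h n x \<le> ennreal C * h (2 * n) (1 / 2 + 1 / 2 * x)"
    proof (cases "x \<in> {0..<1}")
      case True
      define y where "y = 1 / 2 + 1 / 2 * x"
      have y: "0 \<le> y" "y < 1" "(1 + x) / 2 = y" using True by (auto simp: y_def field_simps)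
      have "x \<le> y\<^sup>2" using sum_squares_ge_zero[of "1 - x" 0] by (simp add: y_def power2_eq_square algebra_simps)
      then have "x ^ n \<le> (y\<^sup>2) ^ n" using True by (intro power_mono) auto
      then have "real (Suc n) * x ^ n \<le> real (Suc (2 * n)) * y ^ (2 * n)"
        using True by (intro mult_mono) (auto simp: power_mult)
      moreover have "weight_tail \<omega> x \<le> C * weight_tail \<omega> y" using C(2)[of x] True y by simp
      ultimately have "real (Suc n) * x ^ n * weight_tail \<omega> x \<le> (real (Suc (2 * n)) * y ^ (2 * n)) * (C * weight_tail \<omega> y)"
        by (rule mult_mono) (use True y tail_pos[of x] in auto)
      moreover have "h n x = ennreal (real (Suc n) * x ^ n * weight_tail \<omega> x)"
        using True by (simp add: h_def ennreal_mult' del: of_nat_Suc)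
      moreover have "ennreal C * h (2 * n) y = ennreal ((real (Suc (2 * n)) * y ^ (2 * n)) * (C * weight_tail \<omega> y))"
        using y C(1) less_imp_le[OF tail_pos[of y]] by (simp add: h_def ennreal_mult' mult_ac del: of_nat_Suc)
      ultimately show ?thesis by (simp add: y_def ennreal_leI del: of_nat_Suc)
    qed (simp add: h_def)
  qed
  also have "\<dots> = ennreal (2 * C) * (ennreal (1 / 2) * (\<integral>\<^sup>+x. h (2 * n) (1 / 2 + 1 / 2 * x) \<partial>lborel))"
  proof -
    have "ennreal C = ennreal (2 * C) * ennreal (1 / 2)"
      by (subst ennreal_mult[symmetric]) (use C(1) in auto)
    moreover have "(\<integral>\<^sup>+x. ennreal C * h (2 * n) (1 / 2 + 1 / 2 * x) \<partial>lborel)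
        = ennreal C * (\<integral>\<^sup>+x. h (2 * n) (1 / 2 + 1 / 2 * x) \<partial>lborel)"
      by (rule nn_integral_cmult) measurable
    ultimately show ?thesis by (simp only: mult.assoc)
  qed
  also have "\<dots> = ennreal (2 * C) * (\<integral>\<^sup>+x. h (2 * n) x \<partial>lborel)"
    using nn_integral_real_affine[OF hm, of "1 / 2" "2 * n" "1 / 2"] by simp
  also have "\<dots> = ennreal (2 * C * moment \<omega> (2 * n + 1))"
    using C(1) moment_pos[of "Suc (2 * n)"] by (simp add: cake[symmetric] ennreal_mult)
  finally show ?thesis
    using C(1) moment_pos[of "2 * n + 1"] by (subst (asm) ennreal_le_iff) auto
qed

text \<open>One application of the previous lemma takes \<open>n\<close> to \<open>2 * n - 1\<close>, slightly short of \<open>2 * n + 1\<close>; a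
  second one suffices for \<open>n \<ge> 2\<close>. The indices 0 and 1 only contribute a constant.\<close>
lemma moment_doubling_of_D_hat:
  assumes "\<omega> \<in> D_hat"
  obtains A where "0 \<le> A" "\<And>n. moment \<omega> n \<le> A * moment \<omega> (2 * n + 1)"
proof -
  obtain C where C: "1 \<le> C" "\<And>r. 0 \<le> r \<Longrightarrow> r < 1 \<Longrightarrow> weight_tail \<omega> r \<le> C * weight_tail \<omega> ((1 + r) / 2)"
    using assms by (auto simp: D_hat_def)
  then have step: "moment \<omega> (Suc n) \<le> 2 * C * moment \<omega> (2 * n + 1)" for n
    by (intro moment_le_moment_of_D_hat) auto
  define A where "A = (2 * C)\<^sup>2 + moment \<omega> 0 / moment \<omega> 1 + moment \<omega> 1 / moment \<omega> 3"
  have q: "0 \<le> moment \<omega> 0 / moment \<omega> 1" "0 \<le> moment \<omega> 1 / moment \<omega> 3" "0 \<le> (2 * C)\<^sup>2"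
    using moment_pos[of 0] moment_pos[of 1] moment_pos[of 3] by simp_all
  have "moment \<omega> n \<le> A * moment \<omega> (2 * n + 1)" for n
  proof -
    consider "n = 0" | "n = 1" | m where "n = Suc m" "1 \<le> m"
      by (metis One_nat_def Suc_leI not0_implies_Suc not_gr_zero)
    then show ?thesis
    proof cases
      case 1
      have "moment \<omega> 0 = moment \<omega> 0 / moment \<omega> 1 * moment \<omega> 1" using moment_pos[of 1] by simp
      also have "\<dots> \<le> A * moment \<omega> 1" using q moment_pos[of 1] by (intro mult_right_mono) (auto simp: A_def)
      finally show ?thesis using 1 by simp
    next
      case 2
      have "moment \<omega> 1 = moment \<omega> 1 / moment \<omega> 3 * moment \<omega> 3" using moment_pos[of 3] by simp
      also have "\<dots> \<le> A * moment \<omega> 3" using q moment_pos[of 3] by (intro mult_right_mono) (auto simp: A_def)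
      finally show ?thesis using 2 by (simp add: numeral_3_eq_3)
    next
      case 3
      have "moment \<omega> n \<le> 2 * C * moment \<omega> (2 * m + 1)" using step[of m] 3 by simp
      also have "\<dots> \<le> 2 * C * (2 * C * moment \<omega> (2 * (2 * m) + 1))" using step[of "2 * m"] C(1) by simp
      also have "\<dots> \<le> 2 * C * (2 * C * moment \<omega> (2 * n + 1))"
        using C(1) 3 by (intro mult_left_mono moment_antimono) auto
      also have "\<dots> = (2 * C)\<^sup>2 * moment \<omega> (2 * n + 1)" by (simp add: power2_eq_square)
      also have "\<dots> \<le> A * moment \<omega> (2 * n + 1)"
        using q moment_pos[of "2 * n + 1"] by (intro mult_right_mono) (auto simp: A_def)
      finally show ?thesis .
    qed
  qed
  moreover have "0 \<le> A" using q by (simp add: A_def)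
  ultimately show thesis using that by blast
qed

lemma moment_split:
  assumes "0 \<le> \<rho>" "n \<le> N"
  shows "moment \<omega> N \<le> \<rho> ^ (N - n) * moment \<omega> n + weight_tail \<omega> \<rho>"
proof -
  have tail: "weight_tail \<omega> \<rho> = (LINT t:{0..<1}|lebesgue. indicator {\<rho>..} t * \<omega> t)"
    unfolding weight_tail_def set_lebesgue_integral_def using assms
    by (intro Bochner_Integration.integral_cong) (auto simp: indicator_def)
  have int: "set_integrable lebesgue {0..<1} (\<lambda>t. indicator {\<rho>..} t * \<omega> t)"
    using integrable_mult_indicator[OF _ integrable_weight[unfolded set_integrable_def], of "{\<rho>..}"]
    by (simp add: set_integrable_def mult_ac)
  have "moment \<omega> N \<le> (LINT t:{0..<1}|lebesgue. \<rho> ^ (N - n) * (t ^ n * \<omega> t) + indicator {\<rho>..} t * \<omega> t)"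
    unfolding moment_def
  proof (rule set_integral_mono)
    fix t :: real assume t: "t \<in> {0..<1}"
    then have w: "0 \<le> \<omega> t" by (auto intro: nonneg)
    show "t ^ N * \<omega> t \<le> \<rho> ^ (N - n) * (t ^ n * \<omega> t) + indicator {\<rho>..} t * \<omega> t"
    proof (cases "\<rho> \<le> t")
      case True
      have "t ^ N * \<omega> t \<le> 1 * \<omega> t" using t w by (intro mult_right_mono power_le_one) auto
      moreover have "0 \<le> \<rho> ^ (N - n) * (t ^ n * \<omega> t)" using assms t w by simp
      ultimately show ?thesis using True by simp
    next
      case False
      have "t ^ N = t ^ (N - n) * t ^ n" using assms by (simp flip: power_add)
      also have "\<dots> \<le> \<rho> ^ (N - n) * t ^ n" using False t by (intro mult_right_mono power_mono) auto
      finally have "t ^ N * \<omega> t \<le> \<rho> ^ (N - n) * t ^ n * \<omega> t" using w by (rule mult_right_mono)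
      then show ?thesis using False by simp
    qed
  qed (intro integrable_moment set_integral_add int set_integrable_mult_right)+
  also have "\<dots> = \<rho> ^ (N - n) * moment \<omega> n + weight_tail \<omega> \<rho>"
    unfolding tail moment_def by (subst set_integral_add) (auto intro: integrable_moment int)
  finally show ?thesis .
qed

lemma moment_doubling_iterate:
  assumes "0 \<le> K" "\<And>b. 1 \<le> b \<Longrightarrow> moment \<omega> b \<le> K * moment \<omega> (2 * b)" "1 \<le> b"
  shows "moment \<omega> b \<le> K ^ k * moment \<omega> (2 ^ k * b)"
proof (induction k)
  case (Suc k)
  have "moment \<omega> (2 ^ k * b) \<le> K * moment \<omega> (2 * (2 ^ k * b))" using assms(3) by (intro assms(2)) simp
  then have "K ^ k * moment \<omega> (2 ^ k * b) \<le> K ^ k * (K * moment \<omega> (2 * (2 ^ k * b)))"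
    using assms(1) by (intro mult_left_mono) auto
  with Suc show ?case by (simp add: mult_ac)
qed simp

lemma exp_lower_bound_one_minus:
  fixes u :: real
  assumes "0 \<le> u" "u \<le> 1 / 2"
  shows "exp (- 2 * u) \<le> 1 - u"
proof -
  have "u\<^sup>2 \<le> u / 2" using mult_left_mono[OF assms(2,1)] by (simp add: power2_eq_square)
  then have "- 2 * u \<le> ln (1 - u)" using ln_one_minus_pos_lower_bound[OF assms] by simp
  then have "exp (- 2 * u) \<le> exp (ln (1 - u))" by simp
  then show ?thesis using assms by simp
qed

lemma power_exp_small:
  fixes K :: real
  assumes "1 \<le> K"
  obtains k :: nat where "K ^ k * exp (- (2 ^ k - 1) / 4) \<le> 1 / 2"
proof -
  obtain a where a: "K = exp a" using assms by (metis exp_ln less_le_trans zero_less_one)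
  have "(\<lambda>k::nat. exp (a * real k - (2 ^ k - 1) / 4)) \<longlonglongrightarrow> 0" by real_asymp
  then have "eventually (\<lambda>k::nat. exp (a * real k - (2 ^ k - 1) / 4) < 1 / 2) sequentially"
    by (rule order_tendstoD) simp
  then obtain k :: nat where "exp (a * real k - (2 ^ k - 1) / 4) < 1 / 2"
    using eventually_happens'[OF sequentially_bot] by blast
  moreover have "exp (a * real k - (2 ^ k - 1) / 4) = K ^ k * exp (- (2 ^ k - 1) / 4)"
    unfolding a by (simp add: exp_add[symmetric] exp_of_nat_mult[symmetric] algebra_simps diff_divide_distrib)
  ultimately show thesis using that[of k] by simp
qed

text \<open>For \<open>u = 1 - r\<close> and \<open>n\<close> close to \<open>1 / u\<close> the tail at \<open>r\<close> is at most \<open>exp 2\<close> times the moment of order \<open>n\<close>.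
  That moment is at most \<open>K ^ k\<close> times the one of order \<open>2 ^ k * n\<close>, whose part over \<open>[0, (1 + r) / 2)\<close>
  is at most \<open>exp (- (2 ^ k - 1) / 4)\<close> times the moment of order \<open>n\<close>. The exponential beats
  \<open>K ^ k\<close>, so for a suitable \<open>k\<close>, depending on \<open>K\<close> alone, this part is absorbed on the left and the tail at
  \<open>(1 + r) / 2\<close> remains. For \<open>r < 1 / 2\<close> the monotone
  tails are compared with their values at 0 and \<open>3 / 4\<close>.\<close>
lemma D_hat_of_moment_doubling:
  assumes K: "1 \<le> K" "\<And>b. 1 \<le> b \<Longrightarrow> moment \<omega> b \<le> K * moment \<omega> (2 * b)"
  shows "\<omega> \<in> D_hat"
proof -
  obtain k :: nat where k: "K ^ k * exp (- (2 ^ k - 1) / 4) \<le> 1 / 2" using power_exp_small[OF K(1)] .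
  have near: "weight_tail \<omega> r \<le> (2 * exp 2 * K ^ k) * weight_tail \<omega> ((1 + r) / 2)" if r: "1 / 2 \<le> r" "r < 1" for r
  proof -
    define u where "u = 1 - r"
    define n where "n = nat \<lfloor>1 / u\<rfloor>"
    define \<rho> where "\<rho> = (1 + r) / 2"
    have u: "0 < u" "u \<le> 1 / 2" "r = 1 - u" "\<rho> = 1 - u / 2" using r by (auto simp: u_def \<rho>_def field_simps)
    have "2 \<le> 1 / u" using u by (simp add: field_simps)
    then have n: "real n \<le> 1 / u" "1 / u < real n + 1" "2 \<le> n" unfolding n_def by linarith+
    have nu: "real n * u \<le> 1" "1 / 2 \<le> real n * u"
    proof -
      show "real n * u \<le> 1" using n(1) u(1) by (simp add: field_simps)
      have "1 < (real n + 1) * u" using n(2) u(1) by (simp add: field_simps)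
      then show "1 / 2 \<le> real n * u" using u(2) by (simp add: algebra_simps)
    qed
    have "exp (- 2) \<le> exp (- 2 * u) ^ n" using nu(1) by (simp flip: exp_of_nat_mult)
    also have "\<dots> \<le> r ^ n" using exp_lower_bound_one_minus[of u] u by (intro power_mono) auto
    finally have "exp (- 2) * weight_tail \<omega> r \<le> r ^ n * weight_tail \<omega> r"
      using tail_pos[of r] r by (intro mult_right_mono) auto
    also have "\<dots> \<le> moment \<omega> n" using r by (intro tail_le_moment) auto
    finally have 1: "weight_tail \<omega> r \<le> exp 2 * moment \<omega> n" by (simp add: exp_minus field_simps)
    have "\<rho> \<le> exp (- (u / 2))" using exp_ge_add_one_self[of "- (u / 2)"] u by simp
    then have "\<rho> ^ (2 ^ k * n - n) \<le> exp (- (u / 2)) ^ (2 ^ k * n - n)"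
      using u by (intro power_mono) auto
    also have "\<dots> = exp (- ((2 ^ k - 1) * (real n * u)) / 2)"
      by (simp add: exp_of_nat_mult[symmetric] of_nat_diff algebra_simps)
    also have "\<dots> \<le> exp (- (2 ^ k - 1) / 4)"
    proof -
      have "(2 ^ k - 1) * (1 / 2) \<le> (2 ^ k - 1) * (real n * u)"
        using nu(2) by (intro mult_left_mono) auto
      then have "- ((2 ^ k - 1) * (real n * u)) / 2 \<le> - (2 ^ k - 1) / 4" by linarith
      then show ?thesis by (simp only: exp_le_cancel_iff)
    qed
    finally have \<rho>: "\<rho> ^ (2 ^ k * n - n) \<le> exp (- (2 ^ k - 1) / 4)" .
    have "moment \<omega> n \<le> K ^ k * moment \<omega> (2 ^ k * n)"
      using K n(3) by (intro moment_doubling_iterate) auto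
    also have "\<dots> \<le> K ^ k * (exp (- (2 ^ k - 1) / 4) * moment \<omega> n + weight_tail \<omega> \<rho>)"
    proof (intro mult_left_mono)
      have "moment \<omega> (2 ^ k * n) \<le> \<rho> ^ (2 ^ k * n - n) * moment \<omega> n + weight_tail \<omega> \<rho>"
        using u by (intro moment_split) auto
      also have "\<dots> \<le> exp (- (2 ^ k - 1) / 4) * moment \<omega> n + weight_tail \<omega> \<rho>"
        using \<rho> moment_pos[of n] by simp
      finally show "moment \<omega> (2 ^ k * n) \<le> exp (- (2 ^ k - 1) / 4) * moment \<omega> n + weight_tail \<omega> \<rho>" .
    qed (use K(1) in auto)
    also have "\<dots> = (K ^ k * exp (- (2 ^ k - 1) / 4)) * moment \<omega> n + K ^ k * weight_tail \<omega> \<rho>"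
      by (simp add: algebra_simps)
    also have "\<dots> \<le> (1 / 2) * moment \<omega> n + K ^ k * weight_tail \<omega> \<rho>"
      by (rule add_right_mono[OF mult_right_mono[OF k less_imp_le[OF moment_pos]]])
    finally have "moment \<omega> n \<le> 2 * K ^ k * weight_tail \<omega> \<rho>" by simp
    then have "exp 2 * moment \<omega> n \<le> exp 2 * (2 * K ^ k * weight_tail \<omega> \<rho>)" by simp
    also have "\<dots> = (2 * exp 2 * K ^ k) * weight_tail \<omega> ((1 + r) / 2)" by (simp add: \<rho>_def)
    finally show ?thesis using 1 by (rule order_trans[rotated])
  qed
  define C where "C = 1 + 2 * exp 2 * K ^ k + weight_tail \<omega> 0 / weight_tail \<omega> (3 / 4)"
  have q: "0 \<le> 2 * exp 2 * K ^ k" "0 \<le> weight_tail \<omega> 0 / weight_tail \<omega> (3 / 4)"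
    using K(1) tail_pos[of 0] tail_pos[of "3 / 4"] by simp_all
  have "weight_tail \<omega> r \<le> C * weight_tail \<omega> ((1 + r) / 2)" if r: "0 \<le> r" "r < 1" for r
  proof -
    have p: "0 < weight_tail \<omega> ((1 + r) / 2)" using r by (intro tail_pos) auto
    show ?thesis
    proof (cases "1 / 2 \<le> r")
      case True
      have "weight_tail \<omega> r \<le> (2 * exp 2 * K ^ k) * weight_tail \<omega> ((1 + r) / 2)" using near True r by blast
      also have "\<dots> \<le> C * weight_tail \<omega> ((1 + r) / 2)" using p q by (intro mult_right_mono) (auto simp: C_def)
      finally show ?thesis .
    next
      case False
      have "weight_tail \<omega> r \<le> weight_tail \<omega> 0" using r by (intro tail_antimono) auto
      also have "\<dots> = weight_tail \<omega> 0 / weight_tail \<omega> (3 / 4) * weight_tail \<omega> (3 / 4)" using tail_pos[of "3 / 4"] by simp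
      also have "\<dots> \<le> C * weight_tail \<omega> ((1 + r) / 2)"
        using False r q p less_imp_le[OF tail_pos[of "3 / 4"]]
        by (intro mult_mono tail_antimono) (auto simp: C_def)
      finally show ?thesis .
    qed
  qed
  moreover have "1 \<le> C" using q by (simp add: C_def)
  ultimately show ?thesis using radial by (auto simp: D_hat_def)
qed

end

section \<open>Bloch estimates\<close>

lemma norm_le_H_infinity_norm:
  assumes "f \<in> H_infinity" "z \<in> unit_disc"
  shows "cmod (f z) \<le> H_infinity_norm f"
proof -
  obtain B where "\<And>z. z \<in> unit_disc \<Longrightarrow> cmod (f z) \<le> B"
    using assms(1) unfolding H_infinity_def bounded_iff by blast
  then show ?thesis
    unfolding H_infinity_norm_def using assms(2) by (intro cSUP_upper bdd_aboveI2) auto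
qed

lemma geometric_suminf_bound:
  fixes c :: "nat \<Rightarrow> complex"
  assumes z: "cmod z < 1" and c: "\<And>n. cmod (c n) \<le> B" and s: "(\<lambda>n. c n * z ^ n) sums g"
  shows "(1 - (cmod z)\<^sup>2) * cmod g \<le> 2 * B"
proof -
  have B: "0 \<le> B" using order_trans[OF norm_ge_zero c] .
  have sm: "(\<lambda>n. B * cmod z ^ n) sums (B * (1 / (1 - cmod z)))"
    using z by (intro sums_mult geometric_sums) simp
  have "cmod g = norm (\<Sum>n. c n * z ^ n)" using s by (simp add: sums_iff)
  also have "\<dots> \<le> (\<Sum>n. B * cmod z ^ n)"
    using c by (intro norm_suminf_le sums_summable[OF sm]) (simp add: norm_mult norm_power mult_right_mono)
  also have "\<dots> = B * (1 / (1 - cmod z))" using sm by (simp add: sums_iff)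
  finally have "(1 - (cmod z)\<^sup>2) * cmod g \<le> (1 - (cmod z)\<^sup>2) * (B * (1 / (1 - cmod z)))"
    using z by (intro mult_left_mono) (auto simp: power_le_one)
  also have "\<dots> = (1 + cmod z) * B" using z by (simp add: power2_eq_square field_simps)
  also have "\<dots> \<le> 2 * B" using z B by (intro mult_right_mono) auto
  finally show ?thesis .
qed

context weight begin

text \<open>Moment doubling says that \<open>n + 1\<close> times the coefficient of index \<open>n\<close> of \<open>hilbert_op \<omega> f\<close> is bounded by
  a multiple of the supremum of \<open>f\<close>. Then so are the coefficients of the derivative, and the geometric
  series gives the Bloch bound.\<close>
lemma bounded_of_moment_doubling:
  assumes A: "0 \<le> A" "\<And>n. moment \<omega> n \<le> A * moment \<omega> (2 * n + 1)"
  shows "bounded_H_infinity_to_bloch (hilbert_op \<omega>)"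
  unfolding bounded_H_infinity_to_bloch_def
proof (intro exI[of _ "2 * A"] ballI conjI)
  fix f assume f: "f \<in> H_infinity"
  define K where "K = H_infinity_norm f"
  have hol: "f holomorphic_on unit_disc" using f by (simp add: H_infinity_def)
  have K: "cmod (f z) \<le> K" if "z \<in> unit_disc" for z
    unfolding K_def using f that by (rule norm_le_H_infinity_norm)
  have K0: "0 \<le> K" using order_trans[OF norm_ge_zero K[of 0]] by simp
  have coeff: "real (n + 1) * cmod (hilbert_op_coeff f n) \<le> K * A / 2" for n
  proof -
    have "moment \<omega> n / moment \<omega> (2 * n + 1) \<le> A"
      using A(2)[of n] moment_pos[of "2 * n + 1"] by (simp add: divide_le_eq)
    then have "K * (moment \<omega> n / moment \<omega> (2 * n + 1)) / 2 \<le> K * A / 2"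
      using K0 by (intro divide_right_mono mult_left_mono) auto
    moreover have "real (n + 1) * cmod (hilbert_op_coeff f n) \<le>
        real (n + 1) * (K * (moment \<omega> n / (2 * real (n + 1) * moment \<omega> (2 * n + 1))))"
      by (intro mult_left_mono hilbert_op_coeff_bound[OF hol K]) auto
    moreover have "real (n + 1) * (K * (moment \<omega> n / (2 * real (n + 1) * moment \<omega> (2 * n + 1)))) = K * (moment \<omega> n / moment \<omega> (2 * n + 1)) / 2"
    proof -
      have "a * (K * (x / (2 * a * y))) = K * (x / y) / 2" if "a \<noteq> 0" for a x y :: real
        using that by simp
      from this[of "real (n + 1)"] show ?thesis by simp
    qed
    ultimately show ?thesis by linarith
  qed
  have "cmod (diffs (hilbert_op_coeff f) n) \<le> K * A / 2" for n
  proof -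
    have "cmod (diffs (hilbert_op_coeff f) n) = real (n + 1) * cmod (hilbert_op_coeff f (Suc n))"
      by (simp add: diffs_def norm_mult del: of_nat_Suc)
    also have "\<dots> \<le> real (Suc n + 1) * cmod (hilbert_op_coeff f (Suc n))" by (intro mult_right_mono) auto
    also have "\<dots> \<le> K * A / 2" by (rule coeff)
    finally show ?thesis .
  qed
  then have deriv: "(1 - (cmod z)\<^sup>2) * cmod (deriv (hilbert_op \<omega> f) z) \<le> K * A" if "z \<in> unit_disc" for z
    using geometric_suminf_bound[OF _ _ hilbert_op_deriv_sums[OF hol K that], of "K * A / 2"] that by simp
  then have "bdd_above ((\<lambda>z. (1 - (cmod z)\<^sup>2) * cmod (deriv (hilbert_op \<omega> f) z)) ` unit_disc)"
    by (intro bdd_aboveI2[where M = "K * A"]) auto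
  then show "hilbert_op \<omega> f \<in> bloch_space"
    using hilbert_op_holomorphic[OF hol K] by (simp add: bloch_space_def)
  have "(SUP z\<in>unit_disc. (1 - (cmod z)\<^sup>2) * cmod (deriv (hilbert_op \<omega> f) z)) \<le> K * A"
    using deriv by (intro cSUP_least) auto
  moreover have "cmod (hilbert_op \<omega> f 0) \<le> K * A / 2"
    using coeff[of 0] hilbert_op_at_0[of f K, OF hol K] by (simp del: of_nat_Suc)
  moreover have "0 \<le> K * A" using K0 A(1) by simp
  ultimately have "bloch_norm (hilbert_op \<omega> f) \<le> 2 * (K * A)" unfolding bloch_norm_def by linarith
  then show "bloch_norm (hilbert_op \<omega> f) \<le> 2 * A * H_infinity_norm f" by (simp add: K_def mult_ac)
qed

lemma bloch_bound_of_bounded: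
  assumes "bounded_H_infinity_to_bloch (hilbert_op \<omega>)"
  obtains C where "0 \<le> C" "\<And>z. z \<in> unit_disc \<Longrightarrow> (1 - (cmod z)\<^sup>2) * cmod (deriv (hilbert_op \<omega> (\<lambda>_. 1)) z) \<le> C"
proof -
  let ?H = "hilbert_op \<omega> (\<lambda>_. 1)"
  have "(\<lambda>_. 1) \<in> H_infinity" by (auto simp: H_infinity_def intro!: boundedI)
  moreover have "H_infinity_norm (\<lambda>_. 1) = 1" by (simp add: H_infinity_norm_def)
  ultimately obtain C where C: "?H \<in> bloch_space" "bloch_norm ?H \<le> C"
    using assms unfolding bounded_H_infinity_to_bloch_def by (metis mult.right_neutral)
  have le: "(1 - (cmod z)\<^sup>2) * cmod (deriv ?H z) \<le> C" if "z \<in> unit_disc" for z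
  proof -
    have "(1 - (cmod z)\<^sup>2) * cmod (deriv ?H z) \<le> (SUP z\<in>unit_disc. (1 - (cmod z)\<^sup>2) * cmod (deriv ?H z))"
      using C(1) that by (intro cSUP_upper) (auto simp: bloch_space_def)
    also have "\<dots> \<le> bloch_norm ?H" by (simp add: bloch_norm_def)
    finally show ?thesis using C(2) by simp
  qed
  have "0 \<le> C" using le[of 0] by (simp add: order_trans[OF norm_ge_zero])
  with le show thesis using that by blast
qed

lemma hilbert_op_coeff_one: "hilbert_op_coeff (\<lambda>_. 1) n = of_real (moment \<omega> n / (2 * real (n + 1) * moment \<omega> (2 * n + 1)))"
  unfolding hilbert_op_coeff_def moment_def
  by (simp add: set_integral_complex_of_real del: of_real_mult of_real_power flip: of_real_divide)

text \<open>For the constant function 1 all coefficients are nonnegative, so the derivative at a radius \<open>r\<close> bounds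
  the partial sums of its series. At \<open>r = 1 - 1 / (2 * N)\<close> the powers \<open>r ^ n\<close> with \<open>n < N\<close> are at least
  \<open>1 / 2\<close>, by Bernoulli's inequality, while the Bloch bound is of order \<open>N\<close>.\<close>
lemma moment_ratio_sum_bound:
  assumes C: "\<And>z. z \<in> unit_disc \<Longrightarrow> (1 - (cmod z)\<^sup>2) * cmod (deriv (hilbert_op \<omega> (\<lambda>_. 1)) z) \<le> C"
    and N: "1 \<le> N"
  shows "(\<Sum>k=1..N. moment \<omega> k / moment \<omega> (2 * k + 1)) \<le> 16 * C * N"
proof -
  define q where "q = (\<lambda>k. moment \<omega> k / moment \<omega> (2 * k + 1))"
  define r where "r = 1 - 1 / (2 * real N)"
  define D where "D = deriv (hilbert_op \<omega> (\<lambda>_. 1)) (of_real r)"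
  define e where "e = (\<lambda>n. real (Suc n) * (q (Suc n) / (2 * real (Suc (Suc n)))))"
  have r: "0 \<le> r" "r < 1" using N by (auto simp: r_def field_simps)
  have q: "0 < q k" for k using moment_pos by (simp add: q_def)
  have "diffs (hilbert_op_coeff (\<lambda>_. 1)) n * of_real r ^ n = of_real (e n * r ^ n)" for n
    by (simp add: diffs_def hilbert_op_coeff_one e_def q_def)
  moreover have "(\<lambda>n. diffs (hilbert_op_coeff (\<lambda>_. 1)) n * of_real r ^ n) sums D"
    unfolding D_def using r by (intro hilbert_op_deriv_sums[where K = 1]) auto
  ultimately have D: "(\<lambda>n. of_real (e n * r ^ n)) sums D" by (simp only:)
  then have sums: "(\<lambda>n. e n * r ^ n) sums Re D" using sums_Re[OF D] by simp
  \<comment> \<open>the quotient of \<open>n + 1\<close> by \<open>n + 2\<close> is at least \<open>1 / 2\<close>\<close>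
  have e: "q (Suc n) / 4 \<le> e n" for n
    using q[of "Suc n"] by (simp add: e_def field_simps)
  have half: "1 / 2 \<le> r ^ n" if "n < N" for n
  proof -
    have "1 / 2 \<le> 1 + real N * (- 1 / (2 * real N))" using N by simp
    also have "\<dots> \<le> (1 + (- 1 / (2 * real N))) ^ N" using N by (intro Bernoulli_inequality) (auto simp: field_simps)
    also have "\<dots> = r ^ N" by (simp add: r_def)
    also have "\<dots> \<le> r ^ n" using that r by (intro power_decreasing) auto
    finally show ?thesis .
  qed
  have "(\<Sum>k=1..N. q k) / 8 = (\<Sum>n<N. q (Suc n) / 4 * (1 / 2))"
    unfolding sum_divide_distrib by (rule sum.reindex_bij_witness[of _ Suc "\<lambda>k. k - 1"]) auto
  also have "\<dots> \<le> (\<Sum>n<N. e n * r ^ n)"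
    using e half q r by (intro sum_mono mult_mono) (auto intro: order_trans[OF less_imp_le[OF divide_pos_pos] e])
  also have "\<dots> \<le> Re D"
  proof -
    have "0 \<le> e n * r ^ n" for n using e[of n] q[of "Suc n"] r by (intro mult_nonneg_nonneg) auto
    then show ?thesis using sums sum_le_suminf[OF sums_summable[OF sums], of "{..<N}"] by (simp add: sums_iff)
  qed
  also have "\<dots> \<le> cmod D" by (rule complex_Re_le_cmod)
  finally have S: "(\<Sum>k=1..N. q k) / 8 \<le> cmod D" .
  have "1 / (2 * real N) \<le> 1 - r\<^sup>2"
  proof -
    have "r\<^sup>2 \<le> r" using r by (simp add: power2_eq_square mult_left_le)
    then show ?thesis by (simp add: r_def)
  qed
  then have "1 / (2 * real N) * cmod D \<le> (1 - r\<^sup>2) * cmod D" by (intro mult_right_mono) auto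
  also have "\<dots> \<le> C" using C[of "of_real r"] r by (simp add: D_def)
  finally have "cmod D \<le> 2 * C * N" using N by (simp add: field_simps)
  with S show ?thesis unfolding q_def by linarith
qed

text \<open>Each ratio in the previous sum with index between \<open>a\<close> and \<open>b\<close>, where \<open>a\<close> is about \<open>3 * b / 4\<close>, is at
  least \<open>moment \<omega> b / moment \<omega> (2 * a + 1)\<close>. There are about \<open>b / 4\<close> of them and the sum is of order \<open>b\<close>,
  so the moments of order \<open>b\<close> and \<open>3 * b / 2\<close> are comparable. Two such steps pass \<open>2 * b\<close>.\<close>
lemma moment_doubling_of_bounded:
  assumes "bounded_H_infinity_to_bloch (hilbert_op \<omega>)"
  obtains K where "1 \<le> K" "\<And>b. 1 \<le> b \<Longrightarrow> moment \<omega> b \<le> K * moment \<omega> (2 * b)"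
proof -
  obtain C where C: "0 \<le> C" "\<And>z. z \<in> unit_disc \<Longrightarrow> (1 - (cmod z)\<^sup>2) * cmod (deriv (hilbert_op \<omega> (\<lambda>_. 1)) z) \<le> C"
    using bloch_bound_of_bounded[OF assms] by blast
  define D where "D = 64 * C"
  have step: "moment \<omega> b \<le> D * moment \<omega> c" if b: "1 \<le> b" and c: "2 * c \<le> 3 * b + 2" for b c
  proof -
    define a where "a = b - b div 4"
    have a: "1 \<le> a" "c \<le> 2 * a + 1" "a \<le> b" using b c by (auto simp: a_def)
    have "real b / 4 \<le> real (card {a..b})" using b by (simp add: a_def)
    then have "real b / 4 * (moment \<omega> b / moment \<omega> (2 * a + 1)) \<le> (\<Sum>k=a..b. moment \<omega> b / moment \<omega> (2 * a + 1))"
      using moment_pos[of b] moment_pos[of "2 * a + 1"]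
      unfolding sum_constant by (intro mult_right_mono) auto
    also have "\<dots> \<le> (\<Sum>k=a..b. moment \<omega> k / moment \<omega> (2 * k + 1))"
      by (intro sum_mono frac_le moment_antimono moment_pos less_imp_le[OF moment_pos]) auto
    also have "\<dots> \<le> (\<Sum>k=1..b. moment \<omega> k / moment \<omega> (2 * k + 1))"
      using a by (intro sum_mono2) (auto intro!: divide_nonneg_nonneg less_imp_le[OF moment_pos])
    also have "\<dots> \<le> 16 * C * b" using C(2) b by (rule moment_ratio_sum_bound)
    finally have "moment \<omega> b \<le> D * moment \<omega> (2 * a + 1)"
      using b moment_pos[of "2 * a + 1"] by (simp add: D_def field_simps)
    also have "\<dots> \<le> D * moment \<omega> c"
      using C(1) a by (intro mult_left_mono moment_antimono) (auto simp: D_def)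
    finally show ?thesis .
  qed
  have D: "0 \<le> D" using C(1) by (simp add: D_def)
  have "moment \<omega> b \<le> (1 + D\<^sup>2) * moment \<omega> (2 * b)" if b: "1 \<le> b" for b
  proof -
    define c where "c = (3 * b + 2) div 2"
    have c: "1 \<le> c" "2 * c \<le> 3 * b + 2" "2 * (2 * b) \<le> 3 * c + 2" using b by (auto simp: c_def)
    have "moment \<omega> b \<le> D * moment \<omega> c" using b c(2) by (rule step)
    also have "\<dots> \<le> D * (D * moment \<omega> (2 * b))" using D step[OF c(1,3)] by (rule mult_left_mono[rotated])
    also have "\<dots> \<le> (1 + D\<^sup>2) * moment \<omega> (2 * b)"
      using moment_pos[of "2 * b"] by (simp add: power2_eq_square algebra_simps)
    finally show ?thesis .
  qed
  then show thesis using that[of "1 + D\<^sup>2"] by simp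
qed

end

theorem theorem1:
  fixes \<omega> :: "real \<Rightarrow> real"
  assumes "radial_weight \<omega>"
  shows "bounded_H_infinity_to_bloch (hilbert_op \<omega>) \<longleftrightarrow> \<omega> \<in> D_hat"
proof -
  interpret weight \<omega> using assms by unfold_locales
  show ?thesis
    using moment_doubling_of_bounded D_hat_of_moment_doubling
      moment_doubling_of_D_hat bounded_of_moment_doubling by metis
qed

end
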